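(* Let $(M,J)$ be an almost complex manifold. Then $$H^\bullet_{d+d^c}(M,J)=H^\bullet_{\delta+\bar\delta}(M,J)\quad\text{and}\quad H^\bullet_{dd^c}(M,J)=H^\bullet_{\delta\bar\delta}(M,J).$$
   Context: An almost complex manifold $(M,J)$ is a smooth $2m$-manifold with a smooth $(1,1)$-tensor field $J$, $J^2=-\mathrm{Id}$. $A^k$ is the space of smooth complex $k$-forms, with bigrading $A^k=\bigoplus_{p+q=k}A^{p,q}$ induced by $J$. $J$ acts on forms by duality, as an algebra automorphism: $J\alpha=i^{p-q}\alpha$ for $\alpha\in A^{p,q}$. Set $d^c:=J^{-1}dJ$, $\delta:=\tfrac12(d+id^c)$, $\bar\delta:=\tfrac12(d-id^c)$. Let $B^\bullet:=\{\alpha\in A^\bullet:(dd^c+d^cd)\alpha=0\}$ and $C^\bullet:=A^\bullet/\operatorname{Im}(dd^c+d^cd)$ (graded by degree of forms); $d,d^c,\delta,\bar\delta$ act on both. For a pair of operators $(P,Q)\in\{(d,d^c),(\delta,\bar\delta)\}$ define $$H^k_{P+Q}(M,J):=\frac{\ker(P\colon B^k\to B^{k+1})\cap\ker(Q\colon B^k\to B^{k+1})}{\operatorname{Im}(PQ\colon B^{k-2}\to B^k)},$$ $$H^k_{PQ}(M,J):=\frac{\ker(PQ\colon C^k\to C^{k+2})}{\operatorname{Im}(P\colon C^{k-1}\to C^k)+\operatorname{Im}(Q\colon C^{k-1}\to C^k)}.$$ The equalities are equalities of the numerators and of the denominators, hence of the quotient spaces. *)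

theory Defs
  imports "HOL-Analysis.Analysis" "HOL-Library.Function_Algebras" "HOL-Library.Set_Algebras"
begin

section \<open>Smooth manifolds\<close>

text \<open>
  The model space is \<open>Euclidean_space n\<close>: maps \<open>nat \<Rightarrow> real\<close> that vanish from index \<open>n\<close> on.
  Thus the dimension is an ordinary natural number, and \<open>n = 0\<close> is allowed.
\<close>

definition partial_deriv :: "nat \<Rightarrow> ((nat \<Rightarrow> real) \<Rightarrow> real) \<Rightarrow> (nat \<Rightarrow> real) \<Rightarrow> real" where
  "partial_deriv i f x = deriv (\<lambda>t. f (x(i := t))) (x i)"

text \<open>\<open>Ck_on n r V f\<close>: all partial derivatives of \<open>f\<close> of order at most \<open>r\<close> exist and are
  continuous on the open subset \<open>V\<close> of \<open>Euclidean_space n\<close>.\<close>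

primrec Ck_on :: "nat \<Rightarrow> nat \<Rightarrow> (nat \<Rightarrow> real) set \<Rightarrow> ((nat \<Rightarrow> real) \<Rightarrow> real) \<Rightarrow> bool" where
  "Ck_on n 0 V f \<longleftrightarrow> continuous_map (subtopology (Euclidean_space n) V) euclideanreal f"
| "Ck_on n (Suc r) V f \<longleftrightarrow>
     continuous_map (subtopology (Euclidean_space n) V) euclideanreal f \<and>
     (\<forall>i<n. (\<forall>x\<in>V. (\<lambda>t. f (x(i := t))) field_differentiable at (x i)) \<and>
            Ck_on n r V (partial_deriv i f))"

definition smooth_on :: "nat \<Rightarrow> (nat \<Rightarrow> real) set \<Rightarrow> ((nat \<Rightarrow> real) \<Rightarrow> real) \<Rightarrow> bool" where
  "smooth_on n V f \<longleftrightarrow> (\<forall>r. Ck_on n r V f)"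

type_synonym 'a chart = "'a set \<times> ('a \<Rightarrow> nat \<Rightarrow> real)"

record 'a manifold =
  mtop :: "'a topology"
  mdim :: nat
  matlas :: "'a chart set"

definition is_chart :: "'a topology \<Rightarrow> nat \<Rightarrow> 'a chart \<Rightarrow> bool" where
  "is_chart X n = (\<lambda>(U, \<phi>). openin X U \<and> openin (Euclidean_space n) (\<phi> ` U) \<and>
     homeomorphic_map (subtopology X U) (subtopology (Euclidean_space n) (\<phi> ` U)) \<phi>)"

definition charts_compatible :: "nat \<Rightarrow> 'a chart \<Rightarrow> 'a chart \<Rightarrow> bool" where
  "charts_compatible n = (\<lambda>(U, \<phi>) (V, \<psi>).
     \<forall>i<n. smooth_on n (\<phi> ` (U \<inter> V)) (\<lambda>x. \<psi> (inv_into U \<phi> x) i))"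

text \<open>The atlas need not be maximal: the smooth structure is the one it generates.\<close>

definition smooth_manifold :: "'a manifold \<Rightarrow> bool" where
  "smooth_manifold M \<longleftrightarrow>
     Hausdorff_space (mtop M) \<and> second_countable (mtop M) \<and>
     (\<forall>c \<in> matlas M. is_chart (mtop M) (mdim M) c) \<and>
     (\<Union>c \<in> matlas M. fst c) = topspace (mtop M) \<and>
     (\<forall>c \<in> matlas M. \<forall>c' \<in> matlas M. charts_compatible (mdim M) c c')"

text \<open>
  Functions on \<open>M\<close>, vector fields and forms are all represented by total functions that are \<open>0\<close>
  outside their domain, so that HOL equality is equality of the represented objects and
  the pointwise operations of Function_Algebras are the right vector space operations.
\<close>

definition smooth_fun :: "'a manifold \<Rightarrow> ('a \<Rightarrow> real) set" where
  "smooth_fun M = {f. (\<forall>p. p \<notin> topspace (mtop M) \<longrightarrow> f p = 0) \<and>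
     (\<forall>(U, \<phi>) \<in> matlas M. smooth_on (mdim M) (\<phi> ` U) (f \<circ> inv_into U \<phi>))}"

definition smooth_cfun :: "'a manifold \<Rightarrow> ('a \<Rightarrow> complex) set" where
  "smooth_cfun M = {f. Re \<circ> f \<in> smooth_fun M \<and> Im \<circ> f \<in> smooth_fun M}"


section \<open>Vector fields\<close>

text \<open>
  Smooth vector fields are the derivations of the algebra of smooth functions, and smooth tensor
  fields are the maps that are multilinear over that algebra (as in Helgason,
  Differential Geometry, Lie Groups, and Symmetric Spaces, Ch. I).
\<close>

type_synonym 'a vfield = "('a \<Rightarrow> real) \<Rightarrow> 'a \<Rightarrow> real"

definition vector_fields :: "'a manifold \<Rightarrow> 'a vfield set" where
  "vector_fields M = {X.
     (\<forall>f. f \<notin> smooth_fun M \<longrightarrow> X f = 0) \<and>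
     (\<forall>f \<in> smooth_fun M. X f \<in> smooth_fun M) \<and>
     (\<forall>f \<in> smooth_fun M. \<forall>g \<in> smooth_fun M. X (f + g) = X f + X g) \<and>
     (\<forall>c. \<forall>f \<in> smooth_fun M. X (\<lambda>p. c * f p) = (\<lambda>p. c * X f p)) \<and>
     (\<forall>f \<in> smooth_fun M. \<forall>g \<in> smooth_fun M. X (f * g) = X f * g + f * X g)}"

definition fun_scale :: "('a \<Rightarrow> real) \<Rightarrow> 'a vfield \<Rightarrow> 'a vfield" where
  "fun_scale h X = (\<lambda>f. h * X f)"

definition lie_bracket :: "'a vfield \<Rightarrow> 'a vfield \<Rightarrow> 'a vfield" where
  "lie_bracket X Y = (\<lambda>f. X (Y f) - Y (X f))"

definition capply :: "'a vfield \<Rightarrow> ('a \<Rightarrow> complex) \<Rightarrow> 'a \<Rightarrow> complex" where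
  "capply X f = (\<lambda>p. Complex (X (Re \<circ> f) p) (X (Im \<circ> f) p))"

definition tensor_field_1_1 :: "'a manifold \<Rightarrow> ('a vfield \<Rightarrow> 'a vfield) \<Rightarrow> bool" where
  "tensor_field_1_1 M T \<longleftrightarrow>
     (\<forall>X \<in> vector_fields M. T X \<in> vector_fields M) \<and>
     (\<forall>X \<in> vector_fields M. \<forall>Y \<in> vector_fields M. T (X + Y) = T X + T Y) \<and>
     (\<forall>h \<in> smooth_fun M. \<forall>X \<in> vector_fields M. T (fun_scale h X) = fun_scale h (T X))"

definition almost_complex_manifold ::
    "nat \<Rightarrow> 'a manifold \<Rightarrow> ('a vfield \<Rightarrow> 'a vfield) \<Rightarrow> bool" where
  "almost_complex_manifold m M J \<longleftrightarrow>
     smooth_manifold M \<and> mdim M = 2 * m \<and> tensor_field_1_1 M J \<and>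
     (\<forall>X \<in> vector_fields M. J (J X) = - X)"


section \<open>Complex differential forms\<close>

type_synonym 'a form = "'a vfield list \<Rightarrow> 'a \<Rightarrow> complex"

text \<open>A \<open>k\<close>-form takes a list of \<open>k\<close> vector fields. The degree is an integer, and for \<open>k < 0\<close>
  the definition yields the zero space.\<close>

definition forms :: "'a manifold \<Rightarrow> int \<Rightarrow> 'a form set" where
  "forms M k = {\<alpha>.
     (\<forall>Xs. \<not> (int (length Xs) = k \<and> set Xs \<subseteq> vector_fields M) \<longrightarrow> \<alpha> Xs = 0) \<and>
     (\<forall>Xs. int (length Xs) = k \<and> set Xs \<subseteq> vector_fields M \<longrightarrow>
        \<alpha> Xs \<in> smooth_cfun M \<and>
        (\<forall>i < length Xs. \<forall>Y \<in> vector_fields M.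
           \<alpha> (Xs[i := Xs ! i + Y]) = \<alpha> Xs + \<alpha> (Xs[i := Y])) \<and>
        (\<forall>i < length Xs. \<forall>h \<in> smooth_fun M.
           \<alpha> (Xs[i := fun_scale h (Xs ! i)]) = (\<lambda>p. of_real (h p) * \<alpha> Xs p)) \<and>
        (\<forall>i j. i < j \<and> j < length Xs \<and> Xs ! i = Xs ! j \<longrightarrow> \<alpha> Xs = 0))}"

definition cscale :: "complex \<Rightarrow> 'a form \<Rightarrow> 'a form" where
  "cscale c \<alpha> = (\<lambda>Xs p. c * \<alpha> Xs p)"

definition remove_nth :: "nat \<Rightarrow> 'b list \<Rightarrow> 'b list" where
  "remove_nth i xs = take i xs @ drop (Suc i) xs"

text \<open>The exterior derivative, by the invariant (Koszul) formula without the factor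
  \<open>1/(k+1)\<close>. In the double sum \<open>i < j\<close>, so that entry \<open>j\<close> is removed first.\<close>

definition ext_d :: "'a manifold \<Rightarrow> 'a form \<Rightarrow> 'a form" where
  "ext_d M \<alpha> = (\<lambda>Xs. if set Xs \<subseteq> vector_fields M then
     (\<lambda>p. (\<Sum>i<length Xs. (-1) ^ i * capply (Xs ! i) (\<alpha> (remove_nth i Xs)) p) +
          (\<Sum>j<length Xs. \<Sum>i<j. (-1) ^ (i + j) *
             \<alpha> (lie_bracket (Xs ! i) (Xs ! j) # remove_nth i (remove_nth j Xs)) p))
     else 0)"

text \<open>
  The action on forms dual to an endomorphism of the vector fields. For \<open>J\<close> this is
  \<open>(J\<alpha>)(X\<^sub>1,\<dots>,X\<^sub>k) = \<alpha>(J X\<^sub>1,\<dots>,J X\<^sub>k)\<close>: it is \<open>\<alpha> \<mapsto> \<alpha> \<circ> J\<close> on 1-forms, extended as an algebra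
  automorphism. A \<open>(1,0)\<close>-form satisfies \<open>\<alpha> (J X) = i \<alpha> X\<close> and a \<open>(0,1)\<close>-form
  \<open>\<alpha> (J X) = - i \<alpha> X\<close>, so the action is multiplication by \<open>i^(p-q)\<close> on \<open>(p,q)\<close>-forms.
\<close>

definition dual_action :: "'a manifold \<Rightarrow> ('a vfield \<Rightarrow> 'a vfield) \<Rightarrow> 'a form \<Rightarrow> 'a form" where
  "dual_action M T \<alpha> = (\<lambda>Xs. if set Xs \<subseteq> vector_fields M then \<alpha> (map T Xs) else 0)"

definition J_form :: "'a manifold \<Rightarrow> ('a vfield \<Rightarrow> 'a vfield) \<Rightarrow> 'a form \<Rightarrow> 'a form" where
  "J_form M J = dual_action M J"

text \<open>On vector fields the inverse of \<open>J\<close> is \<open>-J\<close>.\<close>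

definition J_form_inv :: "'a manifold \<Rightarrow> ('a vfield \<Rightarrow> 'a vfield) \<Rightarrow> 'a form \<Rightarrow> 'a form" where
  "J_form_inv M J = dual_action M (\<lambda>X. - J X)"

lemma J_form_inverse:
  assumes "almost_complex_manifold m M J" and "\<alpha> \<in> forms M k"
  shows "J_form_inv M J (J_form M J \<alpha>) = \<alpha>" and "J_form M J (J_form_inv M J \<alpha>) = \<alpha>"
proof -
  have J: "J X \<in> vector_fields M" "J (J X) = - X" if "X \<in> vector_fields M" for X
    using assms(1) that by (auto simp: almost_complex_manifold_def tensor_field_1_1_def)
  have mJ: "- J X \<in> vector_fields M" "J (- J X) = X" "- J (J X) = X"
    if "X \<in> vector_fields M" for X
  proof -
    have *: "- J X = J (J (J X))" by (rule J(2)[OF J(1)[OF that], symmetric])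
    show "- J X \<in> vector_fields M" unfolding * using J that by blast
    have "J (- J X) = - (J (J X))" unfolding * by (rule J(2)[OF J(1)[OF J(1)[OF that]]])
    then show "J (- J X) = X" using J that by simp
    show "- J (J X) = X" using J that by simp
  qed
  have zero: "\<alpha> Xs = 0" if "\<not> set Xs \<subseteq> vector_fields M" for Xs
    using assms(2) that by (auto simp: forms_def)
  have 1: "map J (map (\<lambda>X. - J X) Xs) = Xs" "map (\<lambda>X. - J X) (map J Xs) = Xs"
    "set (map J Xs) \<subseteq> vector_fields M" "set (map (\<lambda>X. - J X) Xs) \<subseteq> vector_fields M"
    if "set Xs \<subseteq> vector_fields M" for Xs
    using that J mJ by (auto simp: subset_iff intro!: map_idI)
  show "J_form_inv M J (J_form M J \<alpha>) = \<alpha>"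
    unfolding J_form_inv_def J_form_def dual_action_def
  proof (intro ext)
    fix Xs p
    show "(if set Xs \<subseteq> vector_fields M
       then if set (map (\<lambda>X. - J X) Xs) \<subseteq> vector_fields M
            then \<alpha> (map J (map (\<lambda>X. - J X) Xs)) else 0 else 0) p = \<alpha> Xs p"
      using 1[of Xs] zero[of Xs] by (cases "set Xs \<subseteq> vector_fields M") (simp_all only: if_True if_False simp_thms)
  qed
  show "J_form M J (J_form_inv M J \<alpha>) = \<alpha>"
    unfolding J_form_inv_def J_form_def dual_action_def
  proof (intro ext)
    fix Xs p
    show "(if set Xs \<subseteq> vector_fields M
       then if set (map J Xs) \<subseteq> vector_fields M
            then \<alpha> (map (\<lambda>X. - J X) (map J Xs)) else 0 else 0) p = \<alpha> Xs p"
      using 1[of Xs] zero[of Xs] by (cases "set Xs \<subseteq> vector_fields M") (simp_all only: if_True if_False simp_thms)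
  qed
qed

definition ext_dc :: "'a manifold \<Rightarrow> ('a vfield \<Rightarrow> 'a vfield) \<Rightarrow> 'a form \<Rightarrow> 'a form" where
  "ext_dc M J \<alpha> = J_form_inv M J (ext_d M (J_form M J \<alpha>))"

definition delta :: "'a manifold \<Rightarrow> ('a vfield \<Rightarrow> 'a vfield) \<Rightarrow> 'a form \<Rightarrow> 'a form" where
  "delta M J \<alpha> = cscale (1/2) (ext_d M \<alpha> + cscale \<i> (ext_dc M J \<alpha>))"

definition delta_bar :: "'a manifold \<Rightarrow> ('a vfield \<Rightarrow> 'a vfield) \<Rightarrow> 'a form \<Rightarrow> 'a form" where
  "delta_bar M J \<alpha> = cscale (1/2) (ext_d M \<alpha> - cscale \<i> (ext_dc M J \<alpha>))"


section \<open>The complexes and their cohomologies\<close>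

text \<open>\<open>V/W\<close> as a set of cosets. With the operations of Set_Algebras on sets the definition also
  applies when the elements of \<open>V\<close> are themselves cosets.\<close>

definition quotient_space :: "'b::plus set \<Rightarrow> 'b set \<Rightarrow> 'b set set" where
  "quotient_space V W = (\<lambda>x. x +o W) ` V"

definition dd_anticomm :: "'a manifold \<Rightarrow> ('a vfield \<Rightarrow> 'a vfield) \<Rightarrow> 'a form \<Rightarrow> 'a form" where
  "dd_anticomm M J \<alpha> = ext_d M (ext_dc M J \<alpha>) + ext_dc M J (ext_d M \<alpha>)"

definition B_space :: "'a manifold \<Rightarrow> ('a vfield \<Rightarrow> 'a vfield) \<Rightarrow> int \<Rightarrow> 'a form set" where
  "B_space M J k = {\<alpha> \<in> forms M k. dd_anticomm M J \<alpha> = 0}"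

definition Im_space :: "'a manifold \<Rightarrow> ('a vfield \<Rightarrow> 'a vfield) \<Rightarrow> int \<Rightarrow> 'a form set" where
  "Im_space M J k = dd_anticomm M J ` forms M (k - 2)"

definition C_space :: "'a manifold \<Rightarrow> ('a vfield \<Rightarrow> 'a vfield) \<Rightarrow> int \<Rightarrow> 'a form set set" where
  "C_space M J k = quotient_space (forms M k) (Im_space M J k)"

text \<open>The operator \<open>C\<^sup>j \<rightarrow> C\<^sup>k\<close> induced by \<open>P\<close>, where \<open>k\<close> is the target degree: it maps the
  coset of \<open>\<alpha>\<close> to the coset of \<open>P \<alpha>\<close>.\<close>

definition induced ::
    "'a manifold \<Rightarrow> ('a vfield \<Rightarrow> 'a vfield) \<Rightarrow> int \<Rightarrow> ('a form \<Rightarrow> 'a form) \<Rightarrow> 'a form set \<Rightarrow> 'a form set" where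
  "induced M J k P S = P ` S + Im_space M J k"

definition sum_ker ::
    "'a manifold \<Rightarrow> ('a vfield \<Rightarrow> 'a vfield) \<Rightarrow> ('a form \<Rightarrow> 'a form) \<Rightarrow> ('a form \<Rightarrow> 'a form) \<Rightarrow> int \<Rightarrow> 'a form set" where
  "sum_ker M J P Q k = {\<alpha> \<in> B_space M J k. P \<alpha> = 0} \<inter> {\<alpha> \<in> B_space M J k. Q \<alpha> = 0}"

definition sum_im ::
    "'a manifold \<Rightarrow> ('a vfield \<Rightarrow> 'a vfield) \<Rightarrow> ('a form \<Rightarrow> 'a form) \<Rightarrow> ('a form \<Rightarrow> 'a form) \<Rightarrow> int \<Rightarrow> 'a form set" where
  "sum_im M J P Q k = (\<lambda>\<beta>. P (Q \<beta>)) ` B_space M J (k - 2)"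

definition H_sum ::
    "'a manifold \<Rightarrow> ('a vfield \<Rightarrow> 'a vfield) \<Rightarrow> ('a form \<Rightarrow> 'a form) \<Rightarrow> ('a form \<Rightarrow> 'a form) \<Rightarrow> int \<Rightarrow> 'a form set set" where
  "H_sum M J P Q k = quotient_space (sum_ker M J P Q k) (sum_im M J P Q k)"

text \<open>The zero of \<open>C\<^sup>k\<close> is the coset \<open>Im_space M J k\<close>.\<close>

definition prod_ker ::
    "'a manifold \<Rightarrow> ('a vfield \<Rightarrow> 'a vfield) \<Rightarrow> ('a form \<Rightarrow> 'a form) \<Rightarrow> ('a form \<Rightarrow> 'a form) \<Rightarrow> int \<Rightarrow> 'a form set set" where
  "prod_ker M J P Q k =
     {S \<in> C_space M J k. induced M J (k + 2) P (induced M J (k + 1) Q S) = Im_space M J (k + 2)}"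

definition prod_im ::
    "'a manifold \<Rightarrow> ('a vfield \<Rightarrow> 'a vfield) \<Rightarrow> ('a form \<Rightarrow> 'a form) \<Rightarrow> ('a form \<Rightarrow> 'a form) \<Rightarrow> int \<Rightarrow> 'a form set set" where
  "prod_im M J P Q k =
     induced M J k P ` C_space M J (k - 1) + induced M J k Q ` C_space M J (k - 1)"

definition H_prod ::
    "'a manifold \<Rightarrow> ('a vfield \<Rightarrow> 'a vfield) \<Rightarrow> ('a form \<Rightarrow> 'a form) \<Rightarrow> ('a form \<Rightarrow> 'a form) \<Rightarrow> int \<Rightarrow> 'a form set set set" where
  "H_prod M J P Q k = quotient_space (prod_ker M J P Q k) (prod_im M J P Q k)"

end

theory Submission
  imports Defs
begin

text \<open>
  Write \<open>P = a d + b d\<^sup>c\<close> and \<open>Q = a' d + b' d\<^sup>c\<close> with \<open>a b' - b a' \<noteq> 0\<close>; both pairs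
  \<open>(d, d\<^sup>c)\<close> and \<open>(\<delta>, \<delta>-bar)\<close> are of this kind. Kernels and images of \<open>P\<close> and \<open>Q\<close> taken together only
  depend on the span of \<open>P\<close> and \<open>Q\<close>. As \<open>d\<^sup>2 = 0 = (d\<^sup>c)\<^sup>2\<close>,
  \<open>P Q = (a b' - b a') d d\<^sup>c + b a' (d d\<^sup>c + d\<^sup>c d)\<close>, and the second summand vanishes on \<open>B\<close> and maps to
  zero in \<open>C\<close>.

  The analytic input is that the Koszul formula maps forms to forms and squares to zero. With the
  contraction \<open>\<iota>\<^sub>X\<close> and the Lie derivative \<open>L\<^sub>X\<close>, the formula is equivalent to
  \<open>\<iota>\<^sub>X d = L\<^sub>X - d \<iota>\<^sub>X\<close>. An identity between forms can be checked after contraction, so the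
  tensoriality of \<open>d \<alpha>\<close> and the rules \<open>[L\<^sub>X, L\<^sub>Y] = L\<^bsub>[X,Y]\<^esub>\<close>, \<open>[L\<^sub>X, d] = 0\<close> and \<open>d\<^sup>2 = 0\<close> follow one
  after the other by induction on the list of arguments.
\<close>

section \<open>Smooth functions and vector fields\<close>

lemma eventually_fun_upd_in_open:
  assumes "openin (Euclidean_space n) V" "x \<in> V" "i < n"
  shows "\<forall>\<^sub>F t in nhds (x i). x(i := t) \<in> V"
proof -
  have x: "x \<in> topspace (Euclidean_space n)"
    using assms openin_subset by blast
  \<comment> \<open>As \<open>i < n\<close>, changing coordinate \<open>i\<close> keeps the entries
    from \<open>n\<close> on zero, so the whole coordinate line lies in the model space.\<close>
  have "continuous_map euclideanreal (Euclidean_space n) (\<lambda>t. x(i := t))"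
    unfolding Euclidean_space_def continuous_map_in_subtopology continuous_map_componentwise_UNIV
    using x assms(3) by (auto simp: topspace_Euclidean_space fun_upd_def)
  then have "openin euclideanreal {t \<in> topspace euclideanreal. x(i := t) \<in> V}"
    using assms(1) by (rule openin_continuous_map_preimage)
  then have "open {t. x(i := t) \<in> V}" by simp
  moreover have "x i \<in> {t. x(i := t) \<in> V}" using assms(2) by simp
  ultimately show ?thesis
    unfolding eventually_nhds by blast
qed

text \<open>A partial derivative depends only on the germ along a coordinate line, and near a point
  of the open set \<open>V\<close> that line stays in \<open>V\<close>. The sum and product rules
  below identify \<open>partial_deriv\<close> only at points of \<open>V\<close>, where
  differentiability is known.\<close>

lemma Ck_on_cong:
  assumes V: "openin (Euclidean_space n) V"
    and "\<And>x. x \<in> V \<Longrightarrow> f x = g x" "Ck_on n r V f"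
  shows "Ck_on n r V g"
  using assms(2,3)
proof (induction r arbitrary: f g)
  case 0
  then show ?case by (auto intro: continuous_map_eq)
next
  case (Suc r)
  have ev: "\<forall>\<^sub>F t in nhds (x i). f (x(i := t)) = g (x(i := t))" if "x \<in> V" "i < n" for x i
    using eventually_fun_upd_in_open[OF V that] by eventually_elim (rule Suc.prems(1))
  have "(\<lambda>t. g (x(i := t))) field_differentiable at (x i)"
    "partial_deriv i f x = partial_deriv i g x" if "x \<in> V" "i < n" for x i
  proof -
    have "(\<lambda>t. f (x(i := t))) field_differentiable at (x i)"
      using Suc.prems(2) that by simp
    then show "(\<lambda>t. g (x(i := t))) field_differentiable at (x i)"
      unfolding field_differentiable_def using DERIV_cong_ev[OF refl ev[OF that] refl] by blast
    show "partial_deriv i f x = partial_deriv i g x"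
      unfolding partial_deriv_def by (rule deriv_cong_ev[OF ev[OF that] refl])
  qed
  moreover have "continuous_map (subtopology (Euclidean_space n) V) euclideanreal g"
    using Suc.prems by (auto intro: continuous_map_eq)
  moreover have "Ck_on n r V (partial_deriv i g)" if "i < n" for i
    by (rule Suc.IH[of "partial_deriv i f"]) (use calculation that Suc.prems(2) in auto)
  ultimately show ?case by simp
qed

lemma Ck_on_SucD: "Ck_on n (Suc r) V f \<Longrightarrow> Ck_on n r V f"
  by (induction r arbitrary: f) auto

lemma Ck_on_const: "Ck_on n r V (\<lambda>x. c)"
proof (induction r arbitrary: c)
  case (Suc r)
  have "partial_deriv i (\<lambda>x. c) = (\<lambda>x. 0)" for i
    by (simp add: partial_deriv_def fun_eq_iff)
  then show ?case using Suc by simp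
qed simp

lemma Ck_on_add:
  assumes V: "openin (Euclidean_space n) V"
  shows "Ck_on n r V f \<Longrightarrow> Ck_on n r V g \<Longrightarrow> Ck_on n r V (\<lambda>x. f x + g x)"
proof (induction r arbitrary: f g)
  case (Suc r)
  have "Ck_on n r V (partial_deriv i (\<lambda>x. f x + g x))" if "i < n" for i
  proof (rule Ck_on_cong[OF V, where f = "\<lambda>x. partial_deriv i f x + partial_deriv i g x"])
    show "partial_deriv i f x + partial_deriv i g x = partial_deriv i (\<lambda>x. f x + g x) x"
      if "x \<in> V" for x
      using Suc.prems that \<open>i < n\<close> by (simp add: partial_deriv_def)
    show "Ck_on n r V (\<lambda>x. partial_deriv i f x + partial_deriv i g x)"
      using Suc that by simp
  qed
  then show ?case using Suc.prems
    by (auto intro!: continuous_map_add field_differentiable_add)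
qed (auto intro: continuous_map_add)

lemma Ck_on_mult:
  assumes V: "openin (Euclidean_space n) V"
  shows "Ck_on n r V f \<Longrightarrow> Ck_on n r V g \<Longrightarrow> Ck_on n r V (\<lambda>x. f x * g x)"
proof (induction r arbitrary: f g)
  case (Suc r)
  have "Ck_on n r V (partial_deriv i (\<lambda>x. f x * g x))" if "i < n" for i
  proof (rule Ck_on_cong[OF V, where f = "\<lambda>x. f x * partial_deriv i g x + partial_deriv i f x * g x"])
    show "f x * partial_deriv i g x + partial_deriv i f x * g x = partial_deriv i (\<lambda>x. f x * g x) x"
      if "x \<in> V" for x
      using Suc.prems that \<open>i < n\<close> by (simp add: partial_deriv_def)
    \<comment> \<open>The product rule also contains the undifferentiated factors, for which one
      order of differentiability is given up.\<close>
    have "Ck_on n r V f" "Ck_on n r V g" by (rule Ck_on_SucD, fact)+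
    then show "Ck_on n r V (\<lambda>x. f x * partial_deriv i g x + partial_deriv i f x * g x)"
      using Suc that by (simp add: Ck_on_add[OF V])
  qed
  then show ?case using Suc.prems
    by (auto intro!: continuous_map_real_mult field_differentiable_mult)
qed (auto intro: continuous_map_real_mult)

lemma smooth_funI:
  assumes "\<And>p. p \<notin> topspace (mtop M) \<Longrightarrow> f p = 0"
    and "\<And>U \<phi> r. (U, \<phi>) \<in> matlas M \<Longrightarrow> Ck_on (mdim M) r (\<phi> ` U) (\<lambda>x. f (inv_into U \<phi> x))"
  shows "f \<in> smooth_fun M"
  using assms by (auto simp: smooth_fun_def smooth_on_def o_def)

lemma smooth_funD:
  assumes "f \<in> smooth_fun M"
  shows "p \<notin> topspace (mtop M) \<Longrightarrow> f p = 0"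
    and "(U, \<phi>) \<in> matlas M \<Longrightarrow> Ck_on (mdim M) r (\<phi> ` U) (\<lambda>x. f (inv_into U \<phi> x))"
  using assms by (auto simp: smooth_fun_def smooth_on_def o_def)

lemma smooth_fun_zero: "0 \<in> smooth_fun M"
  by (rule smooth_funI) (auto simp: Ck_on_const)

locale smooth_mfd =
  fixes M :: "'a manifold"
  assumes smooth: "smooth_manifold M"
begin

abbreviation "A \<equiv> smooth_fun M"
abbreviation "CA \<equiv> smooth_cfun M"
abbreviation "V \<equiv> vector_fields M"
abbreviation "d \<equiv> ext_d M"

lemma chart_open: "(U, \<phi>) \<in> matlas M \<Longrightarrow> openin (Euclidean_space (mdim M)) (\<phi> ` U)"
  using smooth by (auto simp: smooth_manifold_def is_chart_def)

lemma smooth_fun_add: "f \<in> A \<Longrightarrow> g \<in> A \<Longrightarrow> f + g \<in> A"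
  by (rule smooth_funI) (auto simp: smooth_funD intro!: Ck_on_add chart_open)

lemma smooth_fun_mult: "f \<in> A \<Longrightarrow> g \<in> A \<Longrightarrow> f * g \<in> A"
  by (rule smooth_funI) (auto simp: smooth_funD intro!: Ck_on_mult chart_open)

lemma smooth_fun_scale: "f \<in> A \<Longrightarrow> (\<lambda>p. c * f p) \<in> A"
  by (rule smooth_funI) (auto simp: smooth_funD intro!: Ck_on_mult Ck_on_const chart_open)

lemma smooth_fun_uminus: "f \<in> A \<Longrightarrow> - f \<in> A"
  using smooth_fun_scale[of f "-1"] by (simp add: fun_Compl_def)

lemma smooth_fun_diff: "f \<in> A \<Longrightarrow> g \<in> A \<Longrightarrow> f - g \<in> A"
  using smooth_fun_add[of f "- g"] smooth_fun_uminus[of g] by simp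

section \<open>The Lie algebra of vector fields\<close>

lemma vector_fieldD:
  assumes "X \<in> V"
  shows "f \<notin> A \<Longrightarrow> X f = 0" "f \<in> A \<Longrightarrow> X f \<in> A"
    "f \<in> A \<Longrightarrow> g \<in> A \<Longrightarrow> X (f + g) = X f + X g"
    "f \<in> A \<Longrightarrow> X (\<lambda>p. c * f p) = (\<lambda>p. c * X f p)"
    "f \<in> A \<Longrightarrow> g \<in> A \<Longrightarrow> X (f * g) = X f * g + f * X g"
  using assms by (auto simp: vector_fields_def)

lemma vector_field_zero: "X \<in> V \<Longrightarrow> X 0 = 0"
  using vector_fieldD(3)[of X 0 0] smooth_fun_zero[of M] by simp

lemma vector_field_uminus: "X \<in> V \<Longrightarrow> f \<in> A \<Longrightarrow> X (- f) = - X f"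
  using vector_fieldD(4)[of X f "-1"] by (simp add: fun_Compl_def)

lemma vector_field_diff:
  assumes "X \<in> V" "f \<in> A" "g \<in> A"
  shows "X (f - g) = X f - X g"
proof -
  have "X (f + - g) = X f + X (- g)"
    by (rule vector_fieldD(3)[OF assms(1,2) smooth_fun_uminus[OF assms(3)]])
  then show ?thesis
    unfolding vector_field_uminus[OF assms(1,3)] by simp
qed

lemmas vector_field_simps = vector_fieldD(2,3,5) vector_field_diff

lemma vector_fieldI:
  assumes "\<And>f. f \<notin> A \<Longrightarrow> X f = 0" "\<And>f. f \<in> A \<Longrightarrow> X f \<in> A"
    "\<And>f g. f \<in> A \<Longrightarrow> g \<in> A \<Longrightarrow> X (f + g) = X f + X g"
    "\<And>c f. f \<in> A \<Longrightarrow> X (\<lambda>p. c * f p) = (\<lambda>p. c * X f p)"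
    "\<And>f g. f \<in> A \<Longrightarrow> g \<in> A \<Longrightarrow> X (f * g) = X f * g + f * X g"
  shows "X \<in> V"
  using assms by (auto simp: vector_fields_def)

lemma vector_fields_add: "X \<in> V \<Longrightarrow> Y \<in> V \<Longrightarrow> X + Y \<in> V"
  by (rule vector_fieldI) (simp_all add: vector_fieldD smooth_fun_add algebra_simps fun_eq_iff)

lemma vector_fields_uminus: "X \<in> V \<Longrightarrow> - X \<in> V"
  by (rule vector_fieldI) (simp_all add: vector_fieldD smooth_fun_uminus algebra_simps fun_eq_iff)

lemma vector_fields_fun_scale: "h \<in> A \<Longrightarrow> X \<in> V \<Longrightarrow> fun_scale h X \<in> V"
  by (rule vector_fieldI)
    (simp_all add: fun_scale_def vector_fieldD smooth_fun_mult algebra_simps fun_eq_iff)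

lemma lie_bracket_apply: "lie_bracket X Y f = X (Y f) - Y (X f)"
  by (simp add: lie_bracket_def)

lemma vector_fields_lie_bracket:
  assumes X: "X \<in> V" and Y: "Y \<in> V"
  shows "lie_bracket X Y \<in> V"
proof -
  note r = vector_fieldD(2,3,5)[OF X] vector_fieldD(2,3,5)[OF Y]
  show ?thesis
  proof (rule vector_fieldI)
    show "lie_bracket X Y f = 0" if "f \<notin> A" for f
      using that by (simp add: lie_bracket_apply vector_fieldD(1)[OF X] vector_fieldD(1)[OF Y]
        vector_field_zero[OF X] vector_field_zero[OF Y])
    fix f assume f: "f \<in> A"
    show "lie_bracket X Y f \<in> A"
      unfolding lie_bracket_apply by (intro smooth_fun_diff r f)
    show "lie_bracket X Y (\<lambda>p. c * f p) = (\<lambda>p. c * lie_bracket X Y f p)" for c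
      unfolding lie_bracket_apply vector_fieldD(4)[OF X f] vector_fieldD(4)[OF Y f]
        vector_fieldD(4)[OF X r(4)[OF f]] vector_fieldD(4)[OF Y r(1)[OF f]]
      by (simp add: fun_eq_iff right_diff_distrib)
    fix g assume g: "g \<in> A"
    show "lie_bracket X Y (f + g) = lie_bracket X Y f + lie_bracket X Y g"
      using f g by (simp add: r lie_bracket_apply)
    show "lie_bracket X Y (f * g) = lie_bracket X Y f * g + f * lie_bracket X Y g"
      using f g by (simp add: r lie_bracket_apply smooth_fun_mult algebra_simps)
  qed
qed

lemmas vector_fields_closed = vector_fields_add vector_fields_uminus vector_fields_fun_scale
  vector_fields_lie_bracket

text \<open>Off \<open>A\<close> every vector field is zero by convention, so smooth test functions
  decide equality of the total functions.\<close>

lemma vector_field_ext: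
  assumes "X \<in> V" "Y \<in> V" "\<And>f. f \<in> A \<Longrightarrow> X f = Y f"
  shows "X = Y"
proof (rule ext)
  show "X f = Y f" for f
    using assms(3) vector_fieldD(1)[OF assms(1), of f] vector_fieldD(1)[OF assms(2), of f]
    by (cases "f \<in> A") simp_all
qed

lemma lie_bracket_add_right:
  assumes X: "X \<in> V" and Y: "Y \<in> V" and Z: "Z \<in> V"
  shows "lie_bracket X (Y + Z) =
    lie_bracket X Y + lie_bracket X Z"
proof (rule vector_field_ext)
  fix f assume "f \<in> A"
  then show "(lie_bracket X (Y + Z)) f =
      (lie_bracket X Y + lie_bracket X Z) f"
    using assms by (simp add: vector_field_simps[OF X] vector_field_simps[OF Y] vector_field_simps[OF Z]
      lie_bracket_apply fun_scale_def smooth_fun_mult algebra_simps)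
qed (intro vector_fields_closed assms)+

lemma lie_bracket_add_left:
  assumes X: "X \<in> V" and Y: "Y \<in> V" and Z: "Z \<in> V"
  shows "lie_bracket (X + Y) Z =
    lie_bracket X Z + lie_bracket Y Z"
proof (rule vector_field_ext)
  fix f assume "f \<in> A"
  then show "(lie_bracket (X + Y) Z) f =
      (lie_bracket X Z + lie_bracket Y Z) f"
    using assms by (simp add: vector_field_simps[OF X] vector_field_simps[OF Y] vector_field_simps[OF Z]
      lie_bracket_apply fun_scale_def smooth_fun_mult algebra_simps)
qed (intro vector_fields_closed assms)+

lemma lie_bracket_fun_scale_right:
  assumes h: "h \<in> A" and X: "X \<in> V" and Y: "Y \<in> V"
  shows "lie_bracket X (fun_scale h Y) =
    fun_scale h (lie_bracket X Y) + fun_scale (X h) Y"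
proof (rule vector_field_ext)
  fix f assume "f \<in> A"
  then show "(lie_bracket X (fun_scale h Y)) f =
      (fun_scale h (lie_bracket X Y) + fun_scale (X h) Y) f"
    using assms by (simp add: vector_field_simps[OF X] vector_field_simps[OF Y]
      lie_bracket_apply fun_scale_def smooth_fun_mult algebra_simps)
qed (intro vector_fields_closed assms vector_fieldD(2)[OF X h])+

text \<open>The rule \<open>[hX, Y] = h [X, Y] - (Y h) X\<close>, rearranged so that the right-hand
  side is a sum to which \<open>iota_plus\<close> applies.\<close>

lemma lie_bracket_fun_scale_left:
  assumes h: "h \<in> A" and X: "X \<in> V" and Y: "Y \<in> V"
  shows "fun_scale h (lie_bracket X Y) =
    lie_bracket (fun_scale h X) Y + fun_scale (Y h) X"
proof (rule vector_field_ext)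
  fix f assume "f \<in> A"
  then show "(fun_scale h (lie_bracket X Y)) f =
      (lie_bracket (fun_scale h X) Y + fun_scale (Y h) X) f"
    using assms by (simp add: vector_field_simps[OF X] vector_field_simps[OF Y]
      lie_bracket_apply fun_scale_def smooth_fun_mult algebra_simps)
qed (intro vector_fields_closed assms vector_fieldD(2)[OF Y h])+

text \<open>The Jacobi identity in the form "bracketing with \<open>X\<close> is a derivation",
  again free of subtraction for the use of \<open>iota_plus\<close>.\<close>

lemma lie_bracket_jacobi:
  assumes X: "X \<in> V" and Y: "Y \<in> V" and Z: "Z \<in> V"
  shows "lie_bracket X (lie_bracket Y Z) =
    lie_bracket (lie_bracket X Y) Z + lie_bracket Y (lie_bracket X Z)"
proof (rule vector_field_ext)
  fix f assume "f \<in> A"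
  then show "(lie_bracket X (lie_bracket Y Z)) f =
      (lie_bracket (lie_bracket X Y) Z + lie_bracket Y (lie_bracket X Z)) f"
    using assms by (simp add: vector_field_simps[OF X] vector_field_simps[OF Y] vector_field_simps[OF Z]
      lie_bracket_apply fun_scale_def smooth_fun_mult algebra_simps)
qed (intro vector_fields_closed assms)+

section \<open>Complex-valued functions and the action of vector fields on them\<close>

lemma smooth_cfun_zero: "0 \<in> CA"
  using smooth_fun_zero[of M] by (simp add: smooth_cfun_def o_def zero_fun_def)

lemma smooth_cfun_add: "f \<in> CA \<Longrightarrow> g \<in> CA \<Longrightarrow> f + g \<in> CA"
  using smooth_fun_add[of "Re \<circ> f" "Re \<circ> g"] smooth_fun_add[of "Im \<circ> f" "Im \<circ> g"]
  by (simp add: smooth_cfun_def o_def plus_fun_def)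

lemma smooth_cfun_cscale: "f \<in> CA \<Longrightarrow> (\<lambda>p. c * f p) \<in> CA"
  using smooth_fun_diff[of "\<lambda>p. Re c * Re (f p)" "\<lambda>p. Im c * Im (f p)"]
    smooth_fun_add[of "\<lambda>p. Re c * Im (f p)" "\<lambda>p. Im c * Re (f p)"]
  by (simp add: smooth_cfun_def o_def plus_fun_def fun_diff_def smooth_fun_scale)

lemma smooth_cfun_rscale: "h \<in> A \<Longrightarrow> f \<in> CA \<Longrightarrow> (\<lambda>p. of_real (h p) * f p) \<in> CA"
  using smooth_fun_mult[of h "Re \<circ> f"] smooth_fun_mult[of h "Im \<circ> f"]
  by (simp add: smooth_cfun_def o_def times_fun_def)

lemma capply_closed: "X \<in> V \<Longrightarrow> f \<in> CA \<Longrightarrow> capply X f \<in> CA"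
  by (simp add: smooth_cfun_def capply_def o_def vector_fieldD)

lemma capply_zero: "X \<in> V \<Longrightarrow> capply X 0 = 0"
  using vector_field_zero[of X]
  by (simp add: capply_def o_def zero_fun_def fun_eq_iff complex_eq_iff)

lemma capply_add: "X \<in> V \<Longrightarrow> f \<in> CA \<Longrightarrow> g \<in> CA \<Longrightarrow> capply X (f + g) = capply X f + capply X g"
  using vector_fieldD(3)[of X "Re \<circ> f" "Re \<circ> g"] vector_fieldD(3)[of X "Im \<circ> f" "Im \<circ> g"]
  by (simp add: smooth_cfun_def capply_def o_def plus_fun_def fun_eq_iff complex_eq_iff)

lemma capply_cscale:
  assumes "X \<in> V" "f \<in> CA"
  shows "capply X (\<lambda>p. c * f p) = (\<lambda>p. c * capply X f p)"
proof -
  have f: "(\<lambda>p. Re (f p)) \<in> A" "(\<lambda>p. Im (f p)) \<in> A"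
    using assms(2) by (auto simp: smooth_cfun_def o_def)
  \<comment> \<open>The real part of \<open>c * f\<close>; the imaginary part follows.\<close>
  have "X (\<lambda>p. Re c * Re (f p) - Im c * Im (f p)) =
      (\<lambda>p. Re c * X (\<lambda>p. Re (f p)) p - Im c * X (\<lambda>p. Im (f p)) p)"
    using vector_field_diff[of X "\<lambda>p. Re c * Re (f p)" "\<lambda>p. Im c * Im (f p)"] assms(1) f
    by (simp add: smooth_fun_scale vector_fieldD(4)[OF assms(1)] fun_diff_def)
  moreover have "X (\<lambda>p. Re c * Im (f p) + Im c * Re (f p)) =
      (\<lambda>p. Re c * X (\<lambda>p. Im (f p)) p + Im c * X (\<lambda>p. Re (f p)) p)"
    using vector_fieldD(3)[of X "\<lambda>p. Re c * Im (f p)" "\<lambda>p. Im c * Re (f p)"] assms(1) f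
    by (simp add: smooth_fun_scale vector_fieldD(4)[OF assms(1)] plus_fun_def)
  ultimately show ?thesis
    by (simp add: capply_def o_def fun_eq_iff complex_eq_iff)
qed

lemma capply_rscale:
  assumes "X \<in> V" "h \<in> A" "f \<in> CA"
  shows "capply X (\<lambda>p. of_real (h p) * f p) =
    (\<lambda>p. of_real (X h p) * f p + of_real (h p) * capply X f p)"
  using vector_fieldD(5)[of X h "Re \<circ> f"] vector_fieldD(5)[of X h "Im \<circ> f"] assms
  by (simp add: smooth_cfun_def capply_def o_def times_fun_def plus_fun_def fun_eq_iff complex_eq_iff)

lemma capply_lie_bracket:
  "capply (lie_bracket X Y) f = capply X (capply Y f) - capply Y (capply X f)"
  by (simp add: capply_def lie_bracket_def o_def fun_eq_iff complex_eq_iff)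

lemma capply_plus: "capply (X + Y) f = capply X f + capply Y f"
  by (simp add: capply_def fun_eq_iff complex_eq_iff)

lemma capply_fun_scale: "capply (fun_scale h X) f = (\<lambda>p. of_real (h p) * capply X f p)"
  by (simp add: capply_def fun_scale_def fun_eq_iff complex_eq_iff)

end

section \<open>Contraction of forms\<close>

definition iota :: "'a vfield \<Rightarrow> 'a form \<Rightarrow> 'a form" where
  "iota X \<alpha> = (\<lambda>Ys. \<alpha> (X # Ys))"

definition rscale :: "('a \<Rightarrow> real) \<Rightarrow> 'a form \<Rightarrow> 'a form" where
  "rscale h \<alpha> = (\<lambda>Xs p. of_real (h p) * \<alpha> Xs p)"

lemma sum_fun_apply: "(\<Sum>i\<in>I. f i) x = (\<Sum>i\<in>I. f i x)"
  by (induction I rule: infinite_finite_induct) auto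

lemma iota_simps [simp]:
  "iota X 0 = 0" "iota X (\<alpha> + \<beta>) = iota X \<alpha> + iota X \<beta>" "iota X (\<alpha> - \<beta>) = iota X \<alpha> - iota X \<beta>"
  "iota X (- \<alpha>) = - iota X \<alpha>" "iota X (cscale c \<alpha>) = cscale c (iota X \<alpha>)"
  "iota X (rscale h \<alpha>) = rscale h (iota X \<alpha>)"
  by (simp_all add: iota_def fun_eq_iff cscale_def rscale_def)

lemma remove_nth_Cons [simp]:
  "remove_nth 0 (X # Ys) = Ys" "remove_nth (Suc i) (X # Ys) = X # remove_nth i Ys"
  by (simp_all add: remove_nth_def)

context smooth_mfd
begin

section \<open>Forms as a module over the smooth functions\<close>

lemma form_zero: "\<alpha> \<in> forms M k \<Longrightarrow> \<not> (int (length Xs) = k \<and> set Xs \<subseteq> V) \<Longrightarrow> \<alpha> Xs = 0"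
  unfolding forms_def mem_Collect_eq by (elim conjE allE[of _ Xs]) (erule mp)

lemma formD:
  assumes "\<alpha> \<in> forms M k" "int (length Xs) = k" "set Xs \<subseteq> V"
  shows "\<alpha> Xs \<in> CA \<and>
    (\<forall>i < length Xs. \<forall>Y \<in> V. \<alpha> (Xs[i := Xs ! i + Y]) = \<alpha> Xs + \<alpha> (Xs[i := Y])) \<and>
    (\<forall>i < length Xs. \<forall>h \<in> A. \<alpha> (Xs[i := fun_scale h (Xs ! i)]) = (\<lambda>p. of_real (h p) * \<alpha> Xs p)) \<and>
    (\<forall>i j. i < j \<and> j < length Xs \<and> Xs ! i = Xs ! j \<longrightarrow> \<alpha> Xs = 0)"
  by (rule mp[OF spec[OF conjunct2[OF assms(1)[unfolded forms_def mem_Collect_eq]]]])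
    (intro conjI assms(2,3))

lemma form_closed:
  assumes "\<alpha> \<in> forms M k"
  shows "\<alpha> Xs \<in> CA"
proof (cases "int (length Xs) = k \<and> set Xs \<subseteq> V")
  case True
  then show ?thesis using formD[OF assms] by blast
next
  case False
  show ?thesis unfolding form_zero[OF assms False] by (rule smooth_cfun_zero)
qed

lemma form_update:
  assumes "\<alpha> \<in> forms M k" "int (length Xs) = k" "set Xs \<subseteq> V" "i < length Xs"
  shows "Y \<in> V \<Longrightarrow> \<alpha> (Xs[i := Xs ! i + Y]) = \<alpha> Xs + \<alpha> (Xs[i := Y])"
    and "h \<in> A \<Longrightarrow> \<alpha> (Xs[i := fun_scale h (Xs ! i)]) = (\<lambda>p. of_real (h p) * \<alpha> Xs p)"
    and "i < j \<Longrightarrow> j < length Xs \<Longrightarrow> Xs ! i = Xs ! j \<Longrightarrow> \<alpha> Xs = 0"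
  using formD[OF assms(1-3)] assms(4) by blast+

lemma forms_memI:
  assumes "\<And>Xs. \<not> (int (length Xs) = k \<and> set Xs \<subseteq> V) \<Longrightarrow> \<alpha> Xs = 0"
    and "\<And>Xs. \<alpha> Xs \<in> CA"
    and "\<And>Xs i Y. int (length Xs) = k \<Longrightarrow> set Xs \<subseteq> V \<Longrightarrow> i < length Xs \<Longrightarrow> Y \<in> V \<Longrightarrow>
      \<alpha> (Xs[i := Xs ! i + Y]) = \<alpha> Xs + \<alpha> (Xs[i := Y])"
    and "\<And>Xs i h. int (length Xs) = k \<Longrightarrow> set Xs \<subseteq> V \<Longrightarrow> i < length Xs \<Longrightarrow> h \<in> A \<Longrightarrow>
      \<alpha> (Xs[i := fun_scale h (Xs ! i)]) = (\<lambda>p. of_real (h p) * \<alpha> Xs p)"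
    and "\<And>Xs i j. int (length Xs) = k \<Longrightarrow> set Xs \<subseteq> V \<Longrightarrow> i < j \<Longrightarrow> j < length Xs \<Longrightarrow>
      Xs ! i = Xs ! j \<Longrightarrow> \<alpha> Xs = 0"
  shows "\<alpha> \<in> forms M k"
  unfolding forms_def mem_Collect_eq
proof (intro conjI allI impI ballI, goal_cases)
  case (1 Xs)
  then show ?case by (rule assms(1))
next
  case (2 Xs)
  show ?case by (rule assms(2))
next
  case (3 Xs i Y)
  then show ?case by (elim conjE) (rule assms(3))
next
  case (4 Xs i h)
  then show ?case by (elim conjE) (rule assms(4))
next
  case (5 Xs i j)
  then show ?case by (elim conjE) (rule assms(5))
qed

lemma forms_zero: "0 \<in> forms M k"
  unfolding forms_def using smooth_cfun_zero by (simp add: fun_eq_iff)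

lemma forms_add:
  assumes \<alpha>: "\<alpha> \<in> forms M k" and \<beta>: "\<beta> \<in> forms M k"
  shows "\<alpha> + \<beta> \<in> forms M k"
proof (rule forms_memI, goal_cases)
  case (1 Xs)
  show ?case using form_zero[OF \<alpha> 1] form_zero[OF \<beta> 1] by simp
next
  case (2 Xs)
  show ?case
    using smooth_cfun_add[OF form_closed[OF \<alpha>] form_closed[OF \<beta>], of Xs Xs] by simp
next
  case (3 Xs i Y)
  show ?case using form_update(1)[OF \<alpha> 3] form_update(1)[OF \<beta> 3] by simp
next
  case (4 Xs i h)
  show ?case
    using form_update(2)[OF \<alpha> 4] form_update(2)[OF \<beta> 4] by (simp add: distrib_left fun_eq_iff)
next
  case (5 Xs i j)
  then have i: "i < length Xs" by simp
  show ?case using form_update(3)[OF \<alpha> 5(1,2) i 5(3-)] form_update(3)[OF \<beta> 5(1,2) i 5(3-)] by simp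
qed

text \<open>Complex constants and real smooth functions both multiply \<open>CA\<close> into itself,
  so one argument serves \<open>forms_cscale\<close> and \<open>forms_rscale\<close>.\<close>

lemma forms_fun_mult:
  assumes \<alpha>: "\<alpha> \<in> forms M k" and u: "\<And>f. f \<in> CA \<Longrightarrow> (\<lambda>p. u p * f p) \<in> CA"
  shows "(\<lambda>Xs p. u p * \<alpha> Xs p) \<in> forms M k"
proof (rule forms_memI, goal_cases)
  case (1 Xs)
  show ?case using form_zero[OF \<alpha> 1] by (simp add: fun_eq_iff)
next
  case (2 Xs)
  show ?case by (rule u[OF form_closed[OF \<alpha>]])
next
  case (3 Xs i Y)
  show ?case using form_update(1)[OF \<alpha> 3] by (simp add: distrib_left fun_eq_iff)
next
  case (4 Xs i h)
  show ?case using form_update(2)[OF \<alpha> 4] by (simp add: fun_eq_iff)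
next
  case (5 Xs i j)
  then have i: "i < length Xs" by simp
  show ?case using form_update(3)[OF \<alpha> 5(1,2) i 5(3-)] by (simp add: fun_eq_iff)
qed

lemma forms_cscale: "\<alpha> \<in> forms M k \<Longrightarrow> cscale c \<alpha> \<in> forms M k"
  unfolding cscale_def by (rule forms_fun_mult[OF _ smooth_cfun_cscale])

lemma forms_rscale: "h \<in> A \<Longrightarrow> \<alpha> \<in> forms M k \<Longrightarrow> rscale h \<alpha> \<in> forms M k"
  unfolding rscale_def by (rule forms_fun_mult[OF _ smooth_cfun_rscale])

lemma forms_uminus: "\<alpha> \<in> forms M k \<Longrightarrow> - \<alpha> \<in> forms M k"
  using forms_cscale[of \<alpha> k "-1"] by (simp add: cscale_def fun_Compl_def)

lemma forms_diff: "\<alpha> \<in> forms M k \<Longrightarrow> \<beta> \<in> forms M k \<Longrightarrow> \<alpha> - \<beta> \<in> forms M k"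
  using forms_add[of \<alpha> k "- \<beta>"] forms_uminus[of \<beta> k] by simp

text \<open>No list has negative length. This is the base case of the inductions on the
  degree.\<close>

lemma forms_neg: "\<alpha> \<in> forms M k \<Longrightarrow> k < 0 \<Longrightarrow> \<alpha> = 0"
  using form_zero[of \<alpha> k] by (auto simp: fun_eq_iff)

section \<open>Tensoriality and alternation in terms of contractions\<close>

lemma iota_forms:
  assumes \<alpha>: "\<alpha> \<in> forms M k" and X: "X \<in> V"
  shows "iota X \<alpha> \<in> forms M (k - 1)"
proof -
  show ?thesis
  proof (rule forms_memI)
    show "iota X \<alpha> Xs = 0" if "\<not> (int (length Xs) = k - 1 \<and> set Xs \<subseteq> V)" for Xs
      using form_zero[OF \<alpha>, of "X # Xs"] that by (auto simp: iota_def)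
    show "iota X \<alpha> Xs \<in> CA" for Xs
      using form_closed[OF \<alpha>] by (simp add: iota_def)
    fix Xs i assume Xs: "int (length Xs) = k - 1" "set Xs \<subseteq> V"
    show "iota X \<alpha> (Xs[i := Xs ! i + Y]) = iota X \<alpha> Xs + iota X \<alpha> (Xs[i := Y])"
      if "i < length Xs" "Y \<in> V" for Y
      using form_update(1)[OF \<alpha>, of "X # Xs" "Suc i" Y] that Xs X by (simp add: iota_def)
    show "iota X \<alpha> (Xs[i := fun_scale h (Xs ! i)]) = (\<lambda>p. of_real (h p) * iota X \<alpha> Xs p)"
      if "i < length Xs" "h \<in> A" for h
      using form_update(2)[OF \<alpha>, of "X # Xs" "Suc i" h] that Xs X by (simp add: iota_def)
    show "iota X \<alpha> Xs = 0" if "i < j" "j < length Xs" "Xs ! i = Xs ! j" for j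
      using form_update(3)[OF \<alpha>, of "X # Xs" "Suc i" "Suc j"] that Xs X by (simp add: iota_def)
  qed
qed

lemma iota_plus:
  assumes \<alpha>: "\<alpha> \<in> forms M k" and X: "X \<in> V" and Y: "Y \<in> V"
  shows "iota (X + Y) \<alpha> = iota X \<alpha> + iota Y \<alpha>"
proof (rule ext)
  fix Xs
  show "iota (X + Y) \<alpha> Xs = (iota X \<alpha> + iota Y \<alpha>) Xs"
  proof (cases "int (length (X # Xs)) = k \<and> set (X # Xs) \<subseteq> V")
    case True
    then show ?thesis
      using form_update(1)[OF \<alpha> _ _ _ Y, of "X # Xs" 0] by (simp add: iota_def)
  next
    case False
    then show ?thesis
      using form_zero[OF \<alpha>, of "X # Xs"] form_zero[OF \<alpha>, of "Y # Xs"]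
        form_zero[OF \<alpha>, of "(X + Y) # Xs"] X Y by (simp add: iota_def)
  qed
qed

lemma iota_fun_scale:
  assumes \<alpha>: "\<alpha> \<in> forms M k" and X: "X \<in> V" and h: "h \<in> A"
  shows "iota (fun_scale h X) \<alpha> = rscale h (iota X \<alpha>)"
proof (rule ext)
  fix Xs
  show "iota (fun_scale h X) \<alpha> Xs = rscale h (iota X \<alpha>) Xs"
  proof (cases "int (length (X # Xs)) = k \<and> set (X # Xs) \<subseteq> V")
    case True
    then show ?thesis
      using form_update(2)[OF \<alpha> _ _ _ h, of "X # Xs" 0] by (simp add: iota_def rscale_def)
  next
    case False
    then show ?thesis
      using form_zero[OF \<alpha>, of "X # Xs"] form_zero[OF \<alpha>, of "fun_scale h X # Xs"] X
      by (simp add: iota_def rscale_def fun_eq_iff)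
  qed
qed

lemma iota_iota_self:
  assumes \<alpha>: "\<alpha> \<in> forms M k" and X: "X \<in> V"
  shows "iota X (iota X \<alpha>) = 0"
proof (rule ext)
  fix Xs
  show "iota X (iota X \<alpha>) Xs = 0 Xs"
  proof (cases "int (length (X # X # Xs)) = k \<and> set (X # X # Xs) \<subseteq> V")
    case True
    then show ?thesis
      using form_update(3)[OF \<alpha>, of "X # X # Xs" 0 1] by (simp add: iota_def)
  next
    case False
    show ?thesis
      using form_zero[OF \<alpha> False] by (simp add: iota_def)
  qed
qed

text \<open>Polarization: in the expansion of the double contraction with \<open>X + Y\<close>,
  which is zero, the two squares vanish and the cross terms remain.\<close>

lemma iota_swap_aux:
  assumes "\<And>X. X \<in> V \<Longrightarrow> iota X \<alpha> \<in> forms M k"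
    and "\<And>X Y. X \<in> V \<Longrightarrow> Y \<in> V \<Longrightarrow> iota (X + Y) \<alpha> = iota X \<alpha> + iota Y \<alpha>"
    and "\<And>X. X \<in> V \<Longrightarrow> iota X (iota X \<alpha>) = 0"
    and X: "X \<in> V" and Y: "Y \<in> V"
  shows "iota X (iota Y \<alpha>) = - iota Y (iota X \<alpha>)"
proof -
  have "0 = iota (X + Y) (iota (X + Y) \<alpha>)"
    using assms(3)[OF vector_fields_add[OF X Y]] by simp
  also have "\<dots> = iota X (iota Y \<alpha>) + iota Y (iota X \<alpha>)"
    using assms by (simp add: iota_plus[where k = k])
  finally show ?thesis by (simp add: eq_neg_iff_add_eq_0)
qed

lemma iota_swap:
  assumes "\<alpha> \<in> forms M k" "X \<in> V" "Y \<in> V"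
  shows "iota X (iota Y \<alpha>) = - iota Y (iota X \<alpha>)"
  by (rule iota_swap_aux[OF iota_forms[OF assms(1)] iota_plus[OF assms(1)]
    iota_iota_self[OF assms(1)] assms(2,3)])

text \<open>Slot \<open>i\<close> moves to the front past \<open>i\<close> arguments, each at the
  cost of one sign by \<open>iota_swap\<close>; the induction peels off the first argument by
  contraction.\<close>

lemma form_update_front:
  assumes "\<alpha> \<in> forms M k" "set Xs \<subseteq> V" "Y \<in> V" "i < length Xs"
  shows "\<alpha> (Xs[i := Y]) p = (-1) ^ i * \<alpha> (Y # remove_nth i Xs) p"
  using assms
proof (induction Xs arbitrary: \<alpha> k i)
  case (Cons X Xs)
  show ?case
  proof (cases i)
    case (Suc j)
    have "\<alpha> (X # Xs[j := Y]) p = (-1) ^ j * iota Y (iota X \<alpha>) (remove_nth j Xs) p"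
      using Cons.IH[OF iota_forms[OF Cons.prems(1)], of X j] Cons.prems Suc by (simp add: iota_def)
    also have "iota Y (iota X \<alpha>) = - iota X (iota Y \<alpha>)"
      using Cons.prems by (intro iota_swap) auto
    finally show ?thesis using Suc by (simp add: iota_def)
  qed simp
qed simp

text \<open>Membership in \<open>forms M k\<close> can be checked on the contractions; the alternating property of
  \<open>\<alpha>\<close> in the first and a later argument follows by moving the latter to the second place.\<close>

lemma formsI:
  assumes nil: "\<alpha> [] \<in> CA" "k \<noteq> 0 \<Longrightarrow> \<alpha> [] = 0"
    and notin: "\<And>X. X \<notin> V \<Longrightarrow> iota X \<alpha> = 0"
    and io: "\<And>X. X \<in> V \<Longrightarrow> iota X \<alpha> \<in> forms M (k - 1)"
    and plus: "\<And>X Y. X \<in> V \<Longrightarrow> Y \<in> V \<Longrightarrow> iota (X + Y) \<alpha> = iota X \<alpha> + iota Y \<alpha>"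
    and scale: "\<And>h X. h \<in> A \<Longrightarrow> X \<in> V \<Longrightarrow> iota (fun_scale h X) \<alpha> = rscale h (iota X \<alpha>)"
    and self: "\<And>X. X \<in> V \<Longrightarrow> iota X (iota X \<alpha>) = 0"
  shows "\<alpha> \<in> forms M k"
proof -
  have Cons: "\<alpha> (X # Xs) = iota X \<alpha> Xs" for X Xs
    by (simp add: iota_def)
  have zero: "\<alpha> Xs = 0" if "\<not> (int (length Xs) = k \<and> set Xs \<subseteq> V)" for Xs
  proof (cases Xs)
    case (Cons X Ys)
    then show ?thesis
      using that form_zero[OF io, of X Ys] notin[of X] by (cases "X \<in> V") (auto simp: iota_def fun_eq_iff)
  qed (use that nil in auto)
  have closed: "\<alpha> Xs \<in> CA" for Xs
  proof (cases Xs)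
    case (Cons X Ys)
    then show ?thesis
      using form_closed[OF io, of X Ys] fun_cong[OF notin, of X Ys] smooth_cfun_zero
      by (cases "X \<in> V") (simp_all add: iota_def)
  qed (use nil in simp)
  have upd: "Y \<in> V \<Longrightarrow> \<alpha> (Xs[i := Xs ! i + Y]) = \<alpha> Xs + \<alpha> (Xs[i := Y])"
    "h \<in> A \<Longrightarrow> \<alpha> (Xs[i := fun_scale h (Xs ! i)]) = (\<lambda>p. of_real (h p) * \<alpha> Xs p)"
    if Xs: "int (length Xs) = k" "set Xs \<subseteq> V" "i < length Xs" for Xs i Y h
  proof -
    obtain Z Zs where Z: "Xs = Z # Zs" "Z \<in> V" "set Zs \<subseteq> V"
      using Xs by (cases Xs) auto
    show "\<alpha> (Xs[i := Xs ! i + Y]) = \<alpha> Xs + \<alpha> (Xs[i := Y])" if "Y \<in> V"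
    proof (cases i)
      case (Suc j)
      then show ?thesis
        using form_update(1)[OF io[OF Z(2)], of Zs j Y] Xs Z that by (auto simp: Cons)
    qed (use plus[OF Z(2) that] Z in \<open>simp add: Cons\<close>)
    show "\<alpha> (Xs[i := fun_scale h (Xs ! i)]) = (\<lambda>p. of_real (h p) * \<alpha> Xs p)" if "h \<in> A"
    proof (cases i)
      case (Suc j)
      then show ?thesis
        using form_update(2)[OF io[OF Z(2)], of Zs j h] Xs Z that by (auto simp: Cons)
    qed (use scale[OF that Z(2)] Z in \<open>simp add: Cons rscale_def\<close>)
  qed
  have alt: "\<alpha> Xs = 0"
    if Xs: "int (length Xs) = k" "set Xs \<subseteq> V" "i < j" "j < length Xs" "Xs ! i = Xs ! j" for Xs i j
  proof -
    obtain Z Zs where Z: "Xs = Z # Zs" "Z \<in> V" "set Zs \<subseteq> V"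
      using Xs by (cases Xs) auto
    obtain l where j: "j = Suc l" using Xs(3) by (cases j) auto
    show ?thesis
    proof (cases i)
      case 0
      then have l: "Zs ! l = Z" "l < length Zs" using Xs Z j by auto
      \<comment> \<open>Since \<open>Zs ! l = Z\<close>, the update of slot \<open>l\<close> by
        \<open>Z\<close> does not change \<open>Zs\<close>; \<open>form_update_front\<close> then
        exhibits the value as a signed double contraction with \<open>Z\<close>.\<close>
      have "\<alpha> Xs p = 0" for p
        using form_update_front[OF io[OF Z(2)] Z(3) Z(2) l(2), of p] self[OF Z(2)] Z(1)
        unfolding l(1)[symmetric] by (simp add: iota_def fun_eq_iff)
      then show ?thesis by (simp add: fun_eq_iff)
    next
      case (Suc i')
      then show ?thesis
        using form_update(3)[OF io[OF Z(2)], of Zs i' l] Xs Z j by (auto simp: Cons)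
    qed
  qed
  show ?thesis
    by (rule forms_memI) (fact zero closed upd alt)+
qed

section \<open>Lie derivative\<close>

text \<open>The Lie derivative is given by its own invariant formula and not by Cartan's formula, so
  that Cartan's formula can serve as the recursion for \<open>d\<close> on lists of
  arguments.\<close>

definition Lie :: "'a vfield \<Rightarrow> 'a form \<Rightarrow> 'a form" where
  "Lie X \<alpha> = (\<lambda>Ys. if set Ys \<subseteq> V
     then capply X (\<alpha> Ys) - (\<Sum>i<length Ys. \<alpha> (Ys[i := lie_bracket X (Ys ! i)])) else 0)"

lemma Lie_Nil: "Lie X \<alpha> [] = capply X (\<alpha> [])"
  by (simp add: Lie_def)

lemma Lie_Cons_notin: "Y \<notin> V \<Longrightarrow> Lie X \<alpha> (Y # Ys) = 0"
  by (simp add: Lie_def)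

text \<open>In the sum over the slots, slot \<open>0\<close> yields the bracket term, and the other
  slots leave \<open>Y\<close> in place. In operator form this is
  \<open>[L_X, iota_Y] = iota_[X,Y]\<close>.\<close>

lemma iota_Lie:
  assumes \<alpha>: "\<alpha> \<in> forms M k" and X: "X \<in> V" and Y: "Y \<in> V"
  shows "iota Y (Lie X \<alpha>) = Lie X (iota Y \<alpha>) - iota (lie_bracket X Y) \<alpha>"
proof (rule ext)
  fix Ys
  show "iota Y (Lie X \<alpha>) Ys = (Lie X (iota Y \<alpha>) - iota (lie_bracket X Y) \<alpha>) Ys"
    \<comment> \<open>If \<open>Ys\<close> contains something other than a vector field, both Lie
      derivatives are cut off to zero and the bracket term has to vanish as well.\<close>
    using form_zero[OF \<alpha>, of "lie_bracket X Y # Ys"] Y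
    by (auto simp: iota_def Lie_def sum.lessThan_Suc_shift simp del: sum.lessThan_Suc)
qed

lemma Lie_Cons:
  assumes "\<alpha> \<in> forms M k" "X \<in> V" "Y \<in> V"
  shows "Lie X \<alpha> (Y # Ys) = Lie X (iota Y \<alpha>) Ys - iota (lie_bracket X Y) \<alpha> Ys"
  using fun_cong[OF iota_Lie[OF assms], of Ys] by (simp add: iota_def)

lemma Lie_zero: "X \<in> V \<Longrightarrow> Lie X 0 = 0"
  by (simp add: Lie_def fun_eq_iff capply_zero)

lemma Lie_add:
  assumes "\<alpha> \<in> forms M k" "\<beta> \<in> forms M l" "X \<in> V"
  shows "Lie X (\<alpha> + \<beta>) = Lie X \<alpha> + Lie X \<beta>"
  using assms(3) form_closed[OF assms(1)] form_closed[OF assms(2)]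
  by (auto simp: Lie_def fun_eq_iff capply_add sum.distrib)

lemma Lie_cscale:
  assumes "\<alpha> \<in> forms M k" "X \<in> V"
  shows "Lie X (cscale c \<alpha>) = cscale c (Lie X \<alpha>)"
  using assms(2) form_closed[OF assms(1)]
  by (auto simp: Lie_def fun_eq_iff cscale_def capply_cscale sum_fun_apply right_diff_distrib
      sum_distrib_left)

lemma Lie_rscale:
  assumes "\<alpha> \<in> forms M k" "X \<in> V" "h \<in> A"
  shows "Lie X (rscale h \<alpha>) = rscale (X h) \<alpha> + rscale h (Lie X \<alpha>)"
proof (intro ext)
  show "Lie X (rscale h \<alpha>) Ys p = (rscale (X h) \<alpha> + rscale h (Lie X \<alpha>)) Ys p" for Ys p
    \<comment> \<open>\<open>form_zero\<close> covers the lists on which \<open>Lie\<close> is cut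
      off: there the term \<open>rscale (X h) \<alpha>\<close> must be zero too.\<close>
    using assms(2,3) form_closed[OF assms(1)] form_zero[OF assms(1), of Ys]
    by (auto simp: Lie_def rscale_def capply_rscale sum_fun_apply right_diff_distrib
      sum_distrib_left)
qed

lemma Lie_uminus:
  assumes "\<alpha> \<in> forms M k" "X \<in> V"
  shows "Lie X (- \<alpha>) = - Lie X \<alpha>"
  using Lie_cscale[OF assms, of "-1"] by (simp add: cscale_def fun_Compl_def)

lemma Lie_diff:
  assumes "\<alpha> \<in> forms M k" "\<beta> \<in> forms M l" "X \<in> V"
  shows "Lie X (\<alpha> - \<beta>) = Lie X \<alpha> - Lie X \<beta>"
  using Lie_add[OF assms(1) forms_uminus[OF assms(2)] assms(3)] Lie_uminus[OF assms(2,3)] by simp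

text \<open>By \<open>iota_Lie\<close> the contractions are a Lie derivative and a contraction of
  forms of degree \<open>k - 1\<close>, so induction on the degree and \<open>formsI\<close>
  apply.\<close>

lemma Lie_forms:
  assumes "\<alpha> \<in> forms M k" "X \<in> V"
  shows "Lie X \<alpha> \<in> forms M k"
  using assms(1)
\<comment> \<open>The measure is \<open>0\<close> exactly for \<open>k < 0\<close>, where only the
  zero form exists; degree \<open>0\<close> belongs to the induction step, with contractions of
  degree \<open>-1\<close>.\<close>
proof (induction "nat (k + 1)" arbitrary: \<alpha> k)
  case 0
  then have "\<alpha> = 0" by (intro forms_neg) auto
  show ?case
    unfolding \<open>\<alpha> = 0\<close> Lie_zero[OF assms(2)] by (rule forms_zero)
next
  case (Suc n)
  note \<alpha> = \<open>\<alpha> \<in> forms M k\<close>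
  note X = assms(2)
  note io = iota_Lie[OF \<alpha> X]
  show ?case
  proof (rule formsI)
    show "Lie X \<alpha> [] \<in> CA"
      using form_closed[OF \<alpha>] X by (simp add: Lie_Nil capply_closed)
    show "Lie X \<alpha> [] = 0" if "k \<noteq> 0"
      using form_zero[OF \<alpha>, of "[]"] that X by (simp add: Lie_Nil capply_zero)
    show "iota Y (Lie X \<alpha>) = 0" if "Y \<notin> V" for Y
      using that by (simp add: iota_def Lie_Cons_notin fun_eq_iff)
    fix Y assume Y: "Y \<in> V"
    have XY: "lie_bracket X Y \<in> V" by (rule vector_fields_lie_bracket[OF X Y])
    show "iota Y (Lie X \<alpha>) \<in> forms M (k - 1)"
      unfolding io[OF Y]
      using Suc.hyps(1)[OF _ iota_forms[OF \<alpha> Y]] Suc.hyps(2) iota_forms[OF \<alpha> XY]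
      by (auto intro!: forms_diff)
    show "iota (Y + Z) (Lie X \<alpha>) = iota Y (Lie X \<alpha>) + iota Z (Lie X \<alpha>)" if Z: "Z \<in> V" for Z
    proof -
      have XZ: "lie_bracket X Z \<in> V" by (rule vector_fields_lie_bracket[OF X Z])
      show ?thesis
        unfolding io[OF Y] io[OF Z] io[OF vector_fields_add[OF Y Z]] lie_bracket_add_right[OF X Y Z]
          iota_plus[OF \<alpha> Y Z] iota_plus[OF \<alpha> XY XZ]
          Lie_add[OF iota_forms[OF \<alpha> Y] iota_forms[OF \<alpha> Z] X]
        by simp
    qed
    show "iota (fun_scale h Y) (Lie X \<alpha>) = rscale h (iota Y (Lie X \<alpha>))" if h: "h \<in> A" for h
    proof -
      have Xh: "X h \<in> A" by (rule vector_fieldD(2)[OF X h])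
      \<comment> \<open>The term with \<open>X h\<close> found here cancels the one that
        \<open>Lie_rscale\<close> produces.\<close>
      have b: "iota (lie_bracket X (fun_scale h Y)) \<alpha> =
          rscale h (iota (lie_bracket X Y) \<alpha>) + rscale (X h) (iota Y \<alpha>)"
        unfolding lie_bracket_fun_scale_right[OF h X Y]
          iota_plus[OF \<alpha> vector_fields_fun_scale[OF h XY] vector_fields_fun_scale[OF Xh Y]]
          iota_fun_scale[OF \<alpha> XY h] iota_fun_scale[OF \<alpha> Y Xh] ..
      show ?thesis
        unfolding io[OF Y] io[OF vector_fields_fun_scale[OF h Y]] iota_fun_scale[OF \<alpha> Y h] b
          Lie_rscale[OF iota_forms[OF \<alpha> Y] X h]
        by (simp add: rscale_def fun_eq_iff right_diff_distrib)
    qed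
    \<comment> \<open>What remains are the two mixed contractions with \<open>Y\<close> and
      \<open>[X, Y]\<close>, which cancel by \<open>iota_swap\<close>.\<close>
    show "iota Y (iota Y (Lie X \<alpha>)) = 0"
      unfolding io[OF Y] iota_simps iota_Lie[OF iota_forms[OF \<alpha> Y] X Y] iota_iota_self[OF \<alpha> Y]
        Lie_zero[OF X] iota_swap[OF \<alpha> Y XY]
      by simp
  qed
qed

text \<open>Stated at a list \<open>Zs\<close> with \<open>\<alpha>\<close> arbitrary: the induction
  absorbs the first argument \<open>Z\<close> and uses the hypothesis for
  \<open>iota Z \<alpha>\<close> on the shorter list. The lemmas on commutators below are proved in
  the same way.\<close>

lemma Lie_plus:
  assumes "\<alpha> \<in> forms M k" and X: "X \<in> V" and Y: "Y \<in> V"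
  shows "Lie (X + Y) \<alpha> Zs = Lie X \<alpha> Zs + Lie Y \<alpha> Zs"
  using assms(1)
proof (induction Zs arbitrary: \<alpha> k)
  case Nil
  show ?case unfolding Lie_Nil by (rule capply_plus)
next
  case (Cons Z Zs)
  note \<alpha> = \<open>\<alpha> \<in> forms M k\<close>
  show ?case
  proof (cases "Z \<in> V")
    case True
    show ?thesis
      unfolding Lie_Cons[OF \<alpha> vector_fields_add[OF X Y] True] Lie_Cons[OF \<alpha> X True]
        Lie_Cons[OF \<alpha> Y True] Cons.IH[OF iota_forms[OF \<alpha> True]] lie_bracket_add_left[OF X Y True]
        iota_plus[OF \<alpha> vector_fields_lie_bracket[OF X True] vector_fields_lie_bracket[OF Y True]]
      by (simp add: fun_eq_iff)
  qed (simp add: Lie_Cons_notin)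
qed

text \<open>On the empty list this is the definition of the bracket acting on functions; each
  further argument contributes an instance of the Jacobi identity.\<close>

lemma Lie_lie_bracket:
  assumes "\<alpha> \<in> forms M k" and X: "X \<in> V" and Y: "Y \<in> V"
  shows "Lie (lie_bracket X Y) \<alpha> Zs = Lie X (Lie Y \<alpha>) Zs - Lie Y (Lie X \<alpha>) Zs"
  using assms(1)
proof (induction Zs arbitrary: \<alpha> k)
  case Nil
  show ?case unfolding Lie_Nil by (rule capply_lie_bracket)
next
  case (Cons Z Zs)
  note \<alpha> = \<open>\<alpha> \<in> forms M k\<close>
  note XY = vector_fields_lie_bracket[OF X Y]
  show ?case
  proof (cases "Z \<in> V")
    case Z: True
    note XZ = vector_fields_lie_bracket[OF X Z] and YZ = vector_fields_lie_bracket[OF Y Z]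
    have jac: "iota (lie_bracket X (lie_bracket Y Z)) \<alpha> =
        iota (lie_bracket (lie_bracket X Y) Z) \<alpha> + iota (lie_bracket Y (lie_bracket X Z)) \<alpha>"
      unfolding lie_bracket_jacobi[OF X Y Z]
      by (rule iota_plus[OF \<alpha> vector_fields_lie_bracket[OF XY Z] vector_fields_lie_bracket[OF Y XZ]])
    \<comment> \<open>The two middle terms together are symmetric in \<open>P\<close> and
      \<open>Q\<close> and drop out of the commutator; the double brackets are then matched by
      \<open>jac\<close>.\<close>
    have *: "Lie P (Lie Q \<alpha>) (Z # Zs) = Lie P (Lie Q (iota Z \<alpha>)) Zs - Lie P (iota (lie_bracket Q Z) \<alpha>) Zs
        - Lie Q (iota (lie_bracket P Z) \<alpha>) Zs + iota (lie_bracket Q (lie_bracket P Z)) \<alpha> Zs"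
      if P: "P \<in> V" and Q: "Q \<in> V" for P Q
    proof -
      note PZ = vector_fields_lie_bracket[OF P Z] and QZ = vector_fields_lie_bracket[OF Q Z]
      show ?thesis
        unfolding Lie_Cons[OF Lie_forms[OF \<alpha> Q] P Z] iota_Lie[OF \<alpha> Q Z] iota_Lie[OF \<alpha> Q PZ]
          Lie_diff[OF Lie_forms[OF iota_forms[OF \<alpha> Z] Q] iota_forms[OF \<alpha> QZ] P]
        by simp
    qed
    show ?thesis
      unfolding Lie_Cons[OF \<alpha> XY Z] Cons.IH[OF iota_forms[OF \<alpha> Z]] *[OF X Y] *[OF Y X] jac
      by (simp add: fun_eq_iff)
  qed (simp add: Lie_Cons_notin)
qed

section \<open>Exterior derivative\<close>

lemma ext_d_Nil: "d \<alpha> [] = 0"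
  by (simp add: ext_d_def fun_eq_iff)

lemma ext_d_Cons_notin: "X \<notin> V \<Longrightarrow> d \<alpha> (X # Ys) = 0"
  by (simp add: ext_d_def)

text \<open>Cartan's formula, from sorting the Koszul sums by whether they involve \<open>X\<close>.
  The terms in which \<open>X\<close> differentiates or enters a bracket make up
  \<open>Lie X \<alpha>\<close>; the others are those of \<open>iota X \<alpha>\<close> with the
  opposite sign.\<close>

lemma ext_d_Cons:
  assumes \<alpha>: "\<alpha> \<in> forms M k" and X: "X \<in> V"
  shows "d \<alpha> (X # Ys) = Lie X \<alpha> Ys - d (iota X \<alpha>) Ys"
proof (cases "set Ys \<subseteq> V")
  case Ys: True
  define n where "n = length Ys"
  \<comment> \<open>The bracket terms that do not involve \<open>X\<close>; there \<open>X\<close>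
    stands behind the bracket, in the second slot.\<close>
  define F where "F i j = \<alpha> (lie_bracket (Ys ! i) (Ys ! j) # X # remove_nth i (remove_nth j Ys))" for i j
  have mem: "Ys ! i \<in> V" if "i < n" for i
    using Ys that unfolding n_def by (meson nth_mem subsetD)
  have "d \<alpha> (X # Ys) p = (Lie X \<alpha> Ys - d (iota X \<alpha>) Ys) p" for p
  proof -
    have 1: "(\<Sum>i<Suc n. (-1) ^ i * capply ((X # Ys) ! i) (\<alpha> (remove_nth i (X # Ys))) p) =
        capply X (\<alpha> Ys) p - (\<Sum>i<n. (-1) ^ i * capply (Ys ! i) (iota X \<alpha> (remove_nth i Ys)) p)"
      by (simp add: sum.lessThan_Suc_shift sum_negf iota_def del: sum.lessThan_Suc)
    \<comment> \<open>The pairs with \<open>i = 0\<close> carry the sign \<open>(-1)^(j+1)\<close>;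
      shifting both indices leaves the remaining signs unchanged.\<close>
    have 2: "(\<Sum>j<Suc n. \<Sum>i<j. (-1) ^ (i + j) *
        \<alpha> (lie_bracket ((X # Ys) ! i) ((X # Ys) ! j) # remove_nth i (remove_nth j (X # Ys))) p) =
        (\<Sum>j<n. - ((-1) ^ j * \<alpha> (lie_bracket X (Ys ! j) # remove_nth j Ys) p)) +
        (\<Sum>j<n. \<Sum>i<j. (-1) ^ (i + j) * F i j p)"
      by (simp add: sum.lessThan_Suc_shift sum.distrib sum_subtractf sum_negf F_def del: sum.lessThan_Suc)
    \<comment> \<open>The sign is absorbed by moving the bracket from the front back into slot
      \<open>j\<close>, as in the definition of \<open>Lie\<close>.\<close>
    have 3: "(-1) ^ j * \<alpha> (lie_bracket X (Ys ! j) # remove_nth j Ys) p = \<alpha> (Ys[j := lie_bracket X (Ys ! j)]) p"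
      if "j < n" for j
      using form_update_front[OF \<alpha> Ys vector_fields_lie_bracket[OF X mem[OF that]]] that
      by (simp add: n_def)
    \<comment> \<open>Swapping \<open>X\<close> with the bracket supplies the minus sign that the
      index shift did not give.\<close>
    have 4: "F i j p = - iota X \<alpha> (lie_bracket (Ys ! i) (Ys ! j) # remove_nth i (remove_nth j Ys)) p"
      if "i < j" "j < n" for i j
    proof -
      have "lie_bracket (Ys ! i) (Ys ! j) \<in> V"
        using that by (intro vector_fields_lie_bracket mem) auto
      from iota_swap[OF \<alpha> X this] show ?thesis
        by (simp add: F_def iota_def fun_eq_iff)
    qed
    have "d \<alpha> (X # Ys) p = capply X (\<alpha> Ys) p -
        (\<Sum>i<n. (-1) ^ i * capply (Ys ! i) (iota X \<alpha> (remove_nth i Ys)) p) +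
        ((\<Sum>j<n. - ((-1) ^ j * \<alpha> (lie_bracket X (Ys ! j) # remove_nth j Ys) p)) +
        (\<Sum>j<n. \<Sum>i<j. (-1) ^ (i + j) * F i j p))"
      unfolding 1[symmetric] 2[symmetric] using Ys X by (simp add: ext_d_def n_def del: sum.lessThan_Suc)
    also have "(\<Sum>j<n. - ((-1) ^ j * \<alpha> (lie_bracket X (Ys ! j) # remove_nth j Ys) p)) =
        - (\<Sum>j<n. \<alpha> (Ys[j := lie_bracket X (Ys ! j)]) p)"
      unfolding sum_negf using 3 by simp
    also have "(\<Sum>j<n. \<Sum>i<j. (-1) ^ (i + j) * F i j p) =
        - (\<Sum>j<n. \<Sum>i<j. (-1) ^ (i + j) *
          iota X \<alpha> (lie_bracket (Ys ! i) (Ys ! j) # remove_nth i (remove_nth j Ys)) p)"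
      unfolding sum_negf[symmetric] using 4 by (intro sum.cong refl) simp
    finally show ?thesis
      using Ys by (simp add: Lie_def ext_d_def n_def sum_fun_apply)
  qed
  then show ?thesis by (rule ext)
next
  case False
  then show ?thesis by (simp add: Lie_def ext_d_def)
qed

lemma iota_ext_d:
  assumes "\<alpha> \<in> forms M k" "X \<in> V"
  shows "iota X (d \<alpha>) = Lie X \<alpha> - d (iota X \<alpha>)"
  using ext_d_Cons[OF assms] by (simp add: iota_def fun_eq_iff)

lemma ext_d_apply:
  assumes "set Xs \<subseteq> V"
  shows "d \<alpha> Xs p = (\<Sum>i<length Xs. (-1) ^ i * capply (Xs ! i) (\<alpha> (remove_nth i Xs)) p) +
    (\<Sum>j<length Xs. \<Sum>i<j. (-1) ^ (i + j) *
      \<alpha> (lie_bracket (Xs ! i) (Xs ! j) # remove_nth i (remove_nth j Xs)) p)"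
  using assms by (simp add: ext_d_def)

lemma ext_d_notin: "\<not> set Xs \<subseteq> V \<Longrightarrow> d \<alpha> Xs = 0"
  by (simp add: ext_d_def)

lemma ext_d_add:
  assumes "\<alpha> \<in> forms M k" "\<beta> \<in> forms M l"
  shows "d (\<alpha> + \<beta>) = d \<alpha> + d \<beta>"
proof (intro ext)
  fix Xs p
  show "d (\<alpha> + \<beta>) Xs p = (d \<alpha> + d \<beta>) Xs p"
  proof (cases "set Xs \<subseteq> V")
    case True
    have *: "capply (Xs ! i) (\<lambda>p. \<alpha> Ys p + \<beta> Ys p) p = capply (Xs ! i) (\<alpha> Ys) p + capply (Xs ! i) (\<beta> Ys) p"
      if "i < length Xs" for i Ys
    proof -
      have "Xs ! i \<in> V" using True that by (meson nth_mem subsetD)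
      from capply_add[OF this form_closed[OF assms(1)] form_closed[OF assms(2)]]
      show ?thesis by (simp add: plus_fun_def)
    qed
    show ?thesis
      unfolding plus_fun_apply ext_d_apply[OF True]
      by (simp add: * distrib_left sum.distrib cong: sum.cong_simp)
  qed (simp add: ext_d_notin)
qed

lemma ext_d_cscale:
  assumes "\<alpha> \<in> forms M k"
  shows "d (cscale c \<alpha>) = cscale c (d \<alpha>)"
proof (intro ext)
  fix Xs p
  show "d (cscale c \<alpha>) Xs p = cscale c (d \<alpha>) Xs p"
  proof (cases "set Xs \<subseteq> V")
    case True
    have *: "capply (Xs ! i) (\<lambda>p. c * \<alpha> Ys p) p = c * capply (Xs ! i) (\<alpha> Ys) p"
      if "i < length Xs" for i Ys
    proof -
      have "Xs ! i \<in> V" using True that by (meson nth_mem subsetD)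
      from capply_cscale[OF this form_closed[OF assms]] show ?thesis by simp
    qed
    show ?thesis
      unfolding cscale_def ext_d_apply[OF True]
      by (simp add: * distrib_left sum_distrib_left mult.left_commute cong: sum.cong_simp)
  qed (simp add: ext_d_notin cscale_def)
qed

lemma ext_d_zero: "d 0 = 0"
  using ext_d_cscale[OF forms_zero, of 0] by (simp add: cscale_def zero_fun_def)

lemma ext_d_uminus: "\<alpha> \<in> forms M k \<Longrightarrow> d (- \<alpha>) = - d \<alpha>"
  using ext_d_cscale[of \<alpha> k "-1"] by (simp add: cscale_def fun_Compl_def)

lemma ext_d_diff: "\<alpha> \<in> forms M k \<Longrightarrow> \<beta> \<in> forms M l \<Longrightarrow> d (\<alpha> - \<beta>) = d \<alpha> - d \<beta>"
  using ext_d_add[of \<alpha> k "- \<beta>" l] forms_uminus[of \<beta> l] ext_d_uminus[of \<beta> l] by simp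

text \<open>Both sides are \<open>dh \<and> \<iota>\<^sub>X \<alpha>\<close>; stating it without the wedge product makes it
  provable by contraction alone.\<close>

lemma Lie_fun_scale:
  assumes "\<alpha> \<in> forms M k" and X: "X \<in> V" and h: "h \<in> A"
  shows "Lie (fun_scale h X) \<alpha> Zs - rscale h (Lie X \<alpha>) Zs =
    d (rscale h (iota X \<alpha>)) Zs - rscale h (d (iota X \<alpha>)) Zs"
  using assms(1)
proof (induction Zs arbitrary: \<alpha> k)
  case Nil
  then show ?case
    by (simp add: Lie_Nil ext_d_Nil capply_fun_scale rscale_def fun_eq_iff)
next
  case (Cons Z Zs)
  note \<alpha> = \<open>\<alpha> \<in> forms M k\<close>
  show ?case
  proof (cases "Z \<in> V")
    case Z: True
    note hX = vector_fields_fun_scale[OF h X]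
    note Zh = vector_fieldD(2)[OF Z h]
    note \<beta> = iota_forms[OF \<alpha> X]
    note \<gamma> = iota_forms[OF iota_forms[OF \<alpha> Z] X]
    have 1: "rscale h (iota (lie_bracket X Z) \<alpha>) =
        iota (lie_bracket (fun_scale h X) Z) \<alpha> + rscale (Z h) (iota X \<alpha>)"
      unfolding iota_fun_scale[OF \<alpha> vector_fields_lie_bracket[OF X Z] h, symmetric]
        lie_bracket_fun_scale_left[OF h X Z]
        iota_plus[OF \<alpha> vector_fields_lie_bracket[OF hX Z] vector_fields_fun_scale[OF Zh X]]
        iota_fun_scale[OF \<alpha> X Zh] ..
    have 2: "rscale h (- iota X (iota Z \<alpha>)) = - rscale h (iota X (iota Z \<alpha>))"
      by (simp add: rscale_def fun_eq_iff)
    \<comment> \<open>Contraction with \<open>Z\<close> turns either side into the same side for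
      \<open>iota Z \<alpha>\<close> plus \<open>(Z h) iota X \<alpha>\<close>. On the left the
      extra term comes from the bracket \<open>[hX, Z]\<close>, on the right from
      \<open>Lie_rscale\<close>.\<close>
    have L: "Lie (fun_scale h X) \<alpha> (Z # Zs) p - rscale h (Lie X \<alpha>) (Z # Zs) p =
        (Lie (fun_scale h X) (iota Z \<alpha>) Zs - rscale h (Lie X (iota Z \<alpha>)) Zs) p
          + rscale (Z h) (iota X \<alpha>) Zs p" for p
      using fun_cong[OF fun_cong[OF 1, of Zs], of p]
      unfolding rscale_def[of h] Lie_Cons[OF \<alpha> hX Z] Lie_Cons[OF \<alpha> X Z]
      by (simp add: algebra_simps)
    have R: "d (rscale h (iota X \<alpha>)) (Z # Zs) p - rscale h (d (iota X \<alpha>)) (Z # Zs) p =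
        rscale (Z h) (iota X \<alpha>) Zs p +
        (d (rscale h (iota X (iota Z \<alpha>))) Zs - rscale h (d (iota X (iota Z \<alpha>))) Zs) p" for p
      unfolding ext_d_Cons[OF forms_rscale[OF h \<beta>] Z] rscale_def[of h "d _"] ext_d_Cons[OF \<beta> Z]
        Lie_rscale[OF \<beta> Z h] iota_simps iota_swap[OF \<alpha> Z X] 2 ext_d_uminus[OF \<gamma>]
        ext_d_uminus[OF forms_rscale[OF h \<gamma>]]
      by (simp add: algebra_simps rscale_def)
    show ?thesis
      unfolding fun_eq_iff fun_diff_def[of "_ (Z # Zs)"] L R Cons.IH[OF iota_forms[OF \<alpha> Z]]
      by simp
  qed (simp add: Lie_Cons_notin ext_d_Cons_notin rscale_def)
qed

text \<open>Neither \<open>Lie X \<alpha>\<close> nor \<open>d (iota X \<alpha>)\<close> is linear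
  over functions in \<open>X\<close>, but by \<open>Lie_fun_scale\<close> their defects agree, so
  the difference \<open>iota X (d \<alpha>)\<close> is tensorial.\<close>

lemma ext_d_forms:
  assumes "\<alpha> \<in> forms M k"
  shows "d \<alpha> \<in> forms M (k + 1)"
  using assms
proof (induction "nat (k + 1)" arbitrary: \<alpha> k)
  case 0
  then have "\<alpha> = 0" by (intro forms_neg) auto
  show ?case unfolding \<open>\<alpha> = 0\<close> ext_d_zero by (rule forms_zero)
next
  case (Suc n)
  note \<alpha> = \<open>\<alpha> \<in> forms M k\<close>
  note io = iota_ext_d[OF \<alpha>]
  show ?case
  proof (rule formsI)
    show "d \<alpha> [] \<in> CA"
      unfolding ext_d_Nil by (rule smooth_cfun_zero)
    show "d \<alpha> [] = 0" by (rule ext_d_Nil)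
    show "iota X (d \<alpha>) = 0" if "X \<notin> V" for X
      using ext_d_Cons_notin[OF that] by (simp add: iota_def fun_eq_iff)
    fix X assume X: "X \<in> V"
    have "d (iota X \<alpha>) \<in> forms M (k - 1 + 1)"
      using Suc.hyps by (intro Suc.hyps(1) iota_forms[OF \<alpha> X]) auto
    then show "iota X (d \<alpha>) \<in> forms M (k + 1 - 1)"
      unfolding io[OF X] using Lie_forms[OF \<alpha> X] by (simp add: forms_diff)
    show "iota (X + Y) (d \<alpha>) = iota X (d \<alpha>) + iota Y (d \<alpha>)" if Y: "Y \<in> V" for Y
      unfolding io[OF X] io[OF Y] io[OF vector_fields_add[OF X Y]] iota_plus[OF \<alpha> X Y]
        ext_d_add[OF iota_forms[OF \<alpha> X] iota_forms[OF \<alpha> Y]]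
      using Lie_plus[OF \<alpha> X Y] by (simp add: fun_eq_iff)
    show "iota (fun_scale h X) (d \<alpha>) = rscale h (iota X (d \<alpha>))" if h: "h \<in> A" for h
    proof (intro ext)
      show "iota (fun_scale h X) (d \<alpha>) Zs p = rscale h (iota X (d \<alpha>)) Zs p" for Zs p
        unfolding io[OF X] io[OF vector_fields_fun_scale[OF h X]] iota_fun_scale[OF \<alpha> X h]
        using fun_cong[OF Lie_fun_scale[OF \<alpha> X h], of Zs p]
        by (simp add: rscale_def algebra_simps)
    qed
    \<comment> \<open>From \<open>Z + Z = Z\<close> for \<open>Z = [X, X]\<close>, additivity of the
      contraction gives \<open>iota Z \<alpha> = 0\<close>.\<close>
    have XX: "lie_bracket X X \<in> V" "lie_bracket X X + lie_bracket X X = lie_bracket X X"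
      using vector_fields_lie_bracket[OF X X] by (simp_all add: lie_bracket_def fun_eq_iff)
    have "iota (lie_bracket X X) \<alpha> = 0"
      using iota_plus[OF \<alpha> XX(1) XX(1)] unfolding XX(2) by simp
    then show "iota X (iota X (d \<alpha>)) = 0"
      unfolding io[OF X] iota_simps iota_Lie[OF \<alpha> X X] iota_ext_d[OF iota_forms[OF \<alpha> X] X]
        iota_iota_self[OF \<alpha> X] ext_d_zero
      by simp
  qed
qed

text \<open>After contraction with \<open>Z\<close>, the defect is the commutator of
  \<open>Lie X\<close> and \<open>Lie Z\<close> minus \<open>Lie [X, Z]\<close>, up to the induction
  hypothesis for \<open>iota Z \<alpha>\<close>.\<close>

lemma ext_d_Lie:
  assumes "\<alpha> \<in> forms M k" and X: "X \<in> V"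
  shows "d (Lie X \<alpha>) Zs = Lie X (d \<alpha>) Zs"
  using assms(1)
proof (induction Zs arbitrary: \<alpha> k)
  case Nil
  show ?case unfolding ext_d_Nil Lie_Nil capply_zero[OF X] ..
next
  case (Cons Z Zs)
  note \<alpha> = \<open>\<alpha> \<in> forms M k\<close>
  show ?case
  proof (cases "Z \<in> V")
    case Z: True
    note XZ = vector_fields_lie_bracket[OF X Z]
    note iZ = iota_forms[OF \<alpha> Z]
    show ?thesis
      unfolding ext_d_Cons[OF Lie_forms[OF \<alpha> X] Z] Lie_Cons[OF ext_d_forms[OF \<alpha>] X Z]
        iota_Lie[OF \<alpha> X Z] iota_ext_d[OF \<alpha> Z] iota_ext_d[OF \<alpha> XZ]
        ext_d_diff[OF Lie_forms[OF iZ X] iota_forms[OF \<alpha> XZ]]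
        Lie_diff[OF Lie_forms[OF \<alpha> Z] ext_d_forms[OF iZ] X]
      using Cons.IH[OF iZ] Lie_lie_bracket[OF \<alpha> X Z, of Zs]
      by (simp add: fun_eq_iff)
  qed (simp add: Lie_Cons_notin ext_d_Cons_notin)
qed

text \<open>Applying Cartan's formula twice leaves
  \<open>Lie Z (d \<alpha>) - d (Lie Z \<alpha>)\<close>, which is zero, and
  \<open>d (d (iota Z \<alpha>))\<close>, which the induction handles.\<close>

lemma ext_d_ext_d:
  assumes "\<alpha> \<in> forms M k"
  shows "d (d \<alpha>) = 0"
proof (rule ext)
  show "d (d \<alpha>) Zs = 0 Zs" for Zs
    using assms
  proof (induction Zs arbitrary: \<alpha> k)
    case Nil
    show ?case by (simp add: ext_d_Nil)
  next
    case (Cons Z Zs)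
    note \<alpha> = \<open>\<alpha> \<in> forms M k\<close>
    show ?case
    proof (cases "Z \<in> V")
      case Z: True
      show ?thesis
        unfolding ext_d_Cons[OF ext_d_forms[OF \<alpha>] Z] iota_ext_d[OF \<alpha> Z]
          ext_d_diff[OF Lie_forms[OF \<alpha> Z] ext_d_forms[OF iota_forms[OF \<alpha> Z]]]
        using Cons.IH[OF iota_forms[OF \<alpha> Z]] ext_d_Lie[OF \<alpha> Z, of Zs]
        by (simp add: fun_eq_iff)
    qed (simp add: ext_d_Cons_notin)
  qed
qed

section \<open>Almost complex structures\<close>

text \<open>For a general tensor field, as it is applied both to \<open>J\<close> and to its inverse
  \<open>-J\<close>.\<close>

lemma dual_action_forms:
  assumes T: "tensor_field_1_1 M T" and \<alpha>: "\<alpha> \<in> forms M k"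
  shows "dual_action M T \<alpha> \<in> forms M k"
proof -
  have TV: "T X \<in> V" if "X \<in> V" for X
    using T that unfolding tensor_field_1_1_def by blast
  have set_map: "set (map T Xs) \<subseteq> V" if "set Xs \<subseteq> V" for Xs
    using TV that by auto
  have act: "dual_action M T \<alpha> Xs = \<alpha> (map T Xs)" if "set Xs \<subseteq> V" for Xs
    using that by (simp add: dual_action_def)
  show ?thesis
  proof (rule forms_memI, goal_cases)
    case (1 Xs)
    then show ?case
      using form_zero[OF \<alpha>, of "map T Xs"] by (auto simp: dual_action_def)
  next
    case (2 Xs)
    show ?case
      using form_closed[OF \<alpha>] smooth_cfun_zero by (simp add: dual_action_def)
  next
    case (3 Xs i Y)
    have Xi: "Xs ! i \<in> V" using 3 by (meson nth_mem subsetD)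
    have sets: "set (Xs[i := Xs ! i + Y]) \<subseteq> V" "set (Xs[i := Y]) \<subseteq> V"
      by (intro set_update_subsetI 3 vector_fields_add Xi)+
    have "T (Xs ! i + Y) = map T Xs ! i + T Y"
      using T Xi 3 unfolding tensor_field_1_1_def by auto
    then show ?case
      using form_update(1)[OF \<alpha> _ set_map[OF 3(2)], of i "T Y"] 3 TV
      unfolding act[OF 3(2)] act[OF sets(1)] act[OF sets(2)] by (simp add: map_update)
  next
    case (4 Xs i h)
    have Xi: "Xs ! i \<in> V" using 4 by (meson nth_mem subsetD)
    have sets: "set (Xs[i := fun_scale h (Xs ! i)]) \<subseteq> V"
      by (intro set_update_subsetI 4 vector_fields_fun_scale Xi)
    have "T (fun_scale h (Xs ! i)) = fun_scale h (map T Xs ! i)"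
      using T Xi 4 unfolding tensor_field_1_1_def by auto
    then show ?case
      using form_update(2)[OF \<alpha> _ set_map[OF 4(2)], of i h] 4
      unfolding act[OF 4(2)] act[OF sets] by (simp add: map_update)
  next
    case (5 Xs i j)
    then show ?case
      unfolding act[OF 5(2)] by (intro form_update(3)[OF \<alpha> _ set_map[OF 5(2)], of i j]) auto
  qed
qed

end

lemma dual_action_add: "dual_action M T (\<alpha> + \<beta>) = dual_action M T \<alpha> + dual_action M T \<beta>"
  by (simp add: dual_action_def fun_eq_iff)

lemma dual_action_cscale: "dual_action M T (cscale c \<alpha>) = cscale c (dual_action M T \<alpha>)"
  by (simp add: dual_action_def cscale_def fun_eq_iff)

locale almost_complex =
  fixes M :: "'a manifold" and J :: "'a vfield \<Rightarrow> 'a vfield" and m :: nat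
  assumes acm: "almost_complex_manifold m M J"

sublocale almost_complex \<subseteq> smooth_mfd
  using acm by unfold_locales (simp add: almost_complex_manifold_def)

context almost_complex
begin

abbreviation "dc \<equiv> ext_dc M J"
abbreviation "D \<equiv> dd_anticomm M J"

lemma tensor_J: "tensor_field_1_1 M J"
  using acm by (simp add: almost_complex_manifold_def)

lemma tensor_minus_J: "tensor_field_1_1 M (\<lambda>X. - J X)"
  unfolding tensor_field_1_1_def
proof (intro conjI ballI)
  fix X assume X: "X \<in> V"
  then have JX: "J X \<in> V" using tensor_J by (simp add: tensor_field_1_1_def)
  then show "- J X \<in> V" by (rule vector_fields_uminus)
  show "- J (X + Y) = - J X + - J Y" if "Y \<in> V" for Y
    using tensor_J X that by (simp add: tensor_field_1_1_def)
  show "- J (fun_scale h X) = fun_scale h (- J X)" if "h \<in> A" for h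
    using tensor_J X that by (simp add: tensor_field_1_1_def fun_scale_def fun_eq_iff)
qed

lemma J_form_forms: "\<alpha> \<in> forms M k \<Longrightarrow> J_form M J \<alpha> \<in> forms M k"
  unfolding J_form_def by (rule dual_action_forms[OF tensor_J])

lemma J_form_inv_forms: "\<alpha> \<in> forms M k \<Longrightarrow> J_form_inv M J \<alpha> \<in> forms M k"
  unfolding J_form_inv_def by (rule dual_action_forms[OF tensor_minus_J])

lemma dc_forms: "\<alpha> \<in> forms M k \<Longrightarrow> dc \<alpha> \<in> forms M (k + 1)"
  unfolding ext_dc_def by (intro J_form_inv_forms ext_d_forms J_form_forms)

lemma dc_add:
  assumes "\<alpha> \<in> forms M k" "\<beta> \<in> forms M l"
  shows "dc (\<alpha> + \<beta>) = dc \<alpha> + dc \<beta>"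
  unfolding ext_dc_def J_form_def J_form_inv_def dual_action_add
    ext_d_add[OF dual_action_forms[OF tensor_J assms(1)] dual_action_forms[OF tensor_J assms(2)]] ..

lemma dc_cscale:
  assumes "\<alpha> \<in> forms M k"
  shows "dc (cscale c \<alpha>) = cscale c (dc \<alpha>)"
  unfolding ext_dc_def J_form_def J_form_inv_def dual_action_cscale
    ext_d_cscale[OF dual_action_forms[OF tensor_J assms]] ..

text \<open>The inner \<open>J\<close> and its inverse cancel, which leaves \<open>d\<close> applied
  twice between the outer ones.\<close>

lemma dc_dc:
  assumes "\<alpha> \<in> forms M k"
  shows "dc (dc \<alpha>) = 0"
  unfolding ext_dc_def J_form_inverse(2)[OF acm ext_d_forms[OF J_form_forms[OF assms]]]
    ext_d_ext_d[OF J_form_forms[OF assms]]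
  by (simp add: J_form_inv_def dual_action_def fun_eq_iff)

text \<open>Two such operators correspond to a 2x2 coefficient matrix; its determinant
  \<open>a * b' - b * a'\<close> governs everything below.\<close>

definition comb :: "complex \<Rightarrow> complex \<Rightarrow> 'a form \<Rightarrow> 'a form" where
  "comb a b \<alpha> = cscale a (d \<alpha>) + cscale b (dc \<alpha>)"

lemma comb_ext_d: "d = comb 1 0"
  by (simp add: comb_def cscale_def fun_eq_iff)

lemma comb_ext_dc: "dc = comb 0 1"
  by (simp add: comb_def cscale_def fun_eq_iff)

lemma comb_delta: "delta M J = comb (1/2) (\<i>/2)"
  by (simp add: comb_def delta_def cscale_def fun_eq_iff field_simps)

lemma comb_delta_bar: "delta_bar M J = comb (1/2) (-\<i>/2)"
  by (simp add: comb_def delta_bar_def cscale_def fun_eq_iff field_simps)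

lemma comb_forms: "\<alpha> \<in> forms M k \<Longrightarrow> comb a b \<alpha> \<in> forms M (k + 1)"
  unfolding comb_def by (intro forms_add forms_cscale ext_d_forms dc_forms)

lemma comb_add:
  assumes "\<alpha> \<in> forms M k" "\<beta> \<in> forms M l"
  shows "comb a b (\<alpha> + \<beta>) = comb a b \<alpha> + comb a b \<beta>"
  unfolding comb_def ext_d_add[OF assms] dc_add[OF assms]
  by (simp add: cscale_def fun_eq_iff distrib_left)

lemma comb_cscale:
  assumes "\<alpha> \<in> forms M k"
  shows "comb a b (cscale c \<alpha>) = cscale c (comb a b \<alpha>)"
  unfolding comb_def ext_d_cscale[OF assms] dc_cscale[OF assms]
  by (simp add: cscale_def fun_eq_iff distrib_left)

text \<open>The squares of \<open>d\<close> and \<open>dc\<close> vanish, and \<open>dc d\<close> is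
  replaced by \<open>D - d dc\<close>.\<close>

lemma comb_comb:
  assumes \<alpha>: "\<alpha> \<in> forms M k"
  shows "comb a b (comb a' b' \<alpha>) = cscale (a * b' - b * a') (d (dc \<alpha>)) + cscale (b * a') (D \<alpha>)"
proof -
  note f = forms_cscale[OF ext_d_forms[OF \<alpha>]] forms_cscale[OF dc_forms[OF \<alpha>]]
  show ?thesis
    unfolding comb_def[of a' b'] comb_add[OF f] comb_cscale[OF ext_d_forms[OF \<alpha>]]
      comb_cscale[OF dc_forms[OF \<alpha>]] comb_def[of a b] ext_d_ext_d[OF \<alpha>] dc_dc[OF \<alpha>] dd_anticomm_def
    by (simp add: cscale_def fun_eq_iff algebra_simps)
qed

lemma D_forms: "\<alpha> \<in> forms M k \<Longrightarrow> D \<alpha> \<in> forms M (k + 2)"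
  using forms_add[OF ext_d_forms[OF dc_forms[of \<alpha> k]] dc_forms[OF ext_d_forms[of \<alpha> k]]]
  by (simp add: dd_anticomm_def add.commute[of k])

lemma D_add:
  assumes "\<alpha> \<in> forms M k" "\<beta> \<in> forms M l"
  shows "D (\<alpha> + \<beta>) = D \<alpha> + D \<beta>"
  unfolding dd_anticomm_def dc_add[OF assms] ext_d_add[OF assms]
    ext_d_add[OF dc_forms[OF assms(1)] dc_forms[OF assms(2)]]
    dc_add[OF ext_d_forms[OF assms(1)] ext_d_forms[OF assms(2)]]
  by (simp add: fun_eq_iff)

lemma D_cscale:
  assumes "\<alpha> \<in> forms M k"
  shows "D (cscale c \<alpha>) = cscale c (D \<alpha>)"
  unfolding dd_anticomm_def dc_cscale[OF assms] ext_d_cscale[OF assms]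
    ext_d_cscale[OF dc_forms[OF assms]] dc_cscale[OF ext_d_forms[OF assms]]
  by (simp add: cscale_def fun_eq_iff distrib_left)

text \<open>Both \<open>d D\<close> and \<open>D d\<close> reduce to \<open>d dc d\<close>, and
  likewise for \<open>dc\<close>. Hence the operators preserve the image of
  \<open>D\<close>.\<close>

lemma comb_D:
  assumes \<alpha>: "\<alpha> \<in> forms M k"
  shows "comb a b (D \<alpha>) = D (comb a b \<alpha>)"
proof -
  note dA = ext_d_forms[OF \<alpha>] and cA = dc_forms[OF \<alpha>]
  have z: "d 0 = 0" "dc 0 = 0"
    using ext_d_zero dc_cscale[OF forms_zero, of 0] by (simp_all add: cscale_def zero_fun_def)
  have "d (D \<alpha>) = D (d \<alpha>)"
    unfolding dd_anticomm_def ext_d_add[OF ext_d_forms[OF cA] dc_forms[OF dA]]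
      ext_d_ext_d[OF cA] ext_d_ext_d[OF \<alpha>] z by simp
  moreover have "dc (D \<alpha>) = D (dc \<alpha>)"
    unfolding dd_anticomm_def dc_add[OF ext_d_forms[OF cA] dc_forms[OF dA]]
      dc_dc[OF dA] dc_dc[OF \<alpha>] z by simp
  ultimately show ?thesis
    unfolding comb_def D_add[OF forms_cscale[OF dA] forms_cscale[OF cA]] D_cscale[OF dA] D_cscale[OF cA]
    by simp
qed

section \<open>Kernels and images on the spaces B\<close>

lemma B_space_cscale: "\<beta> \<in> B_space M J k \<Longrightarrow> cscale c \<beta> \<in> B_space M J k"
  using D_cscale[of \<beta> k c] forms_cscale[of \<beta> k c]
  by (simp add: B_space_def cscale_def fun_eq_iff)

text \<open>The right-hand side is free of the coefficients, so any two admissible pairs can be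
  compared through it. The next lemma and the two on \<open>C\<close> have the same shape.\<close>

lemma sum_ker_comb:
  assumes ne: "a * b' - b * a' \<noteq> 0"
  shows "sum_ker M J (comb a b) (comb a' b') k = {\<alpha> \<in> B_space M J k. d \<alpha> = 0 \<and> dc \<alpha> = 0}"
proof -
  have "comb a b \<alpha> = 0 \<and> comb a' b' \<alpha> = 0 \<longleftrightarrow> d \<alpha> = 0 \<and> dc \<alpha> = 0" for \<alpha>
  proof
    assume *: "comb a b \<alpha> = 0 \<and> comb a' b' \<alpha> = 0"
    \<comment> \<open>Cramer's rule for \<open>d\<close> and \<open>dc\<close>.\<close>
    have "(a * b' - b * a') * d \<alpha> Xs p = b' * comb a b \<alpha> Xs p - b * comb a' b' \<alpha> Xs p"
      "(a * b' - b * a') * dc \<alpha> Xs p = a * comb a' b' \<alpha> Xs p - a' * comb a b \<alpha> Xs p" for Xs p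
      by (simp_all add: comb_def cscale_def algebra_simps)
    then show "d \<alpha> = 0 \<and> dc \<alpha> = 0"
      using * ne by (simp add: fun_eq_iff)
  qed (simp add: comb_def cscale_def fun_eq_iff)
  then show ?thesis unfolding sum_ker_def by blast
qed

lemma sum_im_comb:
  assumes ne: "a * b' - b * a' \<noteq> 0"
  shows "sum_im M J (comb a b) (comb a' b') k = (\<lambda>\<beta>. d (dc \<beta>)) ` B_space M J (k - 2)"
proof -
  have *: "comb a b (comb a' b' \<beta>) = d (dc (cscale (a * b' - b * a') \<beta>))"
    if "\<beta> \<in> B_space M J (k - 2)" for \<beta>
  proof -
    from that have \<beta>: "\<beta> \<in> forms M (k - 2)" and D: "D \<beta> = 0" by (auto simp: B_space_def)
    show ?thesis
      unfolding comb_comb[OF \<beta>] D dc_cscale[OF \<beta>] ext_d_cscale[OF dc_forms[OF \<beta>]]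
      by (simp add: cscale_def fun_eq_iff)
  qed
  have inv: "cscale (a * b' - b * a') (cscale (1 / (a * b' - b * a')) \<beta>) = \<beta>" for \<beta> :: "'a form"
    using ne by (simp add: cscale_def fun_eq_iff)
  show ?thesis
  proof (intro set_eqI iffI)
    fix x assume "x \<in> sum_im M J (comb a b) (comb a' b') k"
    then show "x \<in> (\<lambda>\<beta>. d (dc \<beta>)) ` B_space M J (k - 2)"
      unfolding sum_im_def using * B_space_cscale by blast
  next
    fix x assume "x \<in> (\<lambda>\<beta>. d (dc \<beta>)) ` B_space M J (k - 2)"
    then obtain \<beta> where \<beta>: "\<beta> \<in> B_space M J (k - 2)" "x = d (dc \<beta>)" by blast
    \<comment> \<open>Dividing by the determinant compensates the factor that \<open>*\<close> puts
      in front of \<open>\<beta>\<close>.\<close>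
    let ?\<gamma> = "cscale (1 / (a * b' - b * a')) \<beta>"
    have "?\<gamma> \<in> B_space M J (k - 2)" by (rule B_space_cscale[OF \<beta>(1)])
    moreover have "x = comb a b (comb a' b' ?\<gamma>)"
      unfolding *[OF calculation] inv \<beta>(2) ..
    ultimately show "x \<in> sum_im M J (comb a b) (comb a' b') k"
      unfolding sum_im_def by blast
  qed
qed

section \<open>Cosets of the image of \<open>D\<close> and the operators induced on C\<close>

lemma Im_space_add:
  assumes "x \<in> Im_space M J k" "y \<in> Im_space M J k"
  shows "x + y \<in> Im_space M J k"
proof -
  obtain \<alpha> \<beta> where \<alpha>: "\<alpha> \<in> forms M (k - 2)" "x = D \<alpha>" and \<beta>: "\<beta> \<in> forms M (k - 2)" "y = D \<beta>"
    using assms by (auto simp: Im_space_def)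
  show ?thesis
    unfolding \<alpha>(2) \<beta>(2) D_add[OF \<alpha>(1) \<beta>(1), symmetric] Im_space_def
    by (intro imageI forms_add \<alpha> \<beta>)
qed

lemma Im_space_cscale:
  assumes "x \<in> Im_space M J k"
  shows "cscale c x \<in> Im_space M J k"
proof -
  obtain \<alpha> where \<alpha>: "\<alpha> \<in> forms M (k - 2)" "x = D \<alpha>"
    using assms by (auto simp: Im_space_def)
  show ?thesis
    unfolding \<alpha>(2) D_cscale[OF \<alpha>(1), symmetric] Im_space_def by (intro imageI forms_cscale \<alpha>)
qed

lemma Im_space_zero: "0 \<in> Im_space M J k"
proof -
  have "D 0 \<in> Im_space M J k" unfolding Im_space_def by (intro imageI forms_zero)
  from Im_space_cscale[OF this, of 0] show ?thesis by (simp add: cscale_def zero_fun_def)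
qed

lemma Im_space_uminus: "x \<in> Im_space M J k \<Longrightarrow> - x \<in> Im_space M J k"
  using Im_space_cscale[of x k "-1"] by (simp add: cscale_def fun_Compl_def)

lemma Im_space_forms: "x \<in> Im_space M J k \<Longrightarrow> x \<in> forms M k"
  using D_forms[of _ "k - 2"] by (auto simp: Im_space_def)

lemma comb_Im_space:
  assumes "x \<in> Im_space M J k"
  shows "comb a b x \<in> Im_space M J (k + 1)"
proof -
  obtain \<alpha> where \<alpha>: "\<alpha> \<in> forms M (k - 2)" "x = D \<alpha>" using assms by (auto simp: Im_space_def)
  have "comb a b \<alpha> \<in> forms M (k + 1 - 2)"
    using comb_forms[OF \<alpha>(1), of a b] by (simp add: algebra_simps)
  then show ?thesis
    unfolding \<alpha>(2) comb_D[OF \<alpha>(1)] Im_space_def by (rule imageI)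
qed

lemma coset_eq_Im_space_iff: "x +o Im_space M J k = Im_space M J k \<longleftrightarrow> x \<in> Im_space M J k"
proof
  assume "x +o Im_space M J k = Im_space M J k"
  then show "x \<in> Im_space M J k"
    using set_plus_intro2[OF Im_space_zero, of x k] by simp
next
  assume x: "x \<in> Im_space M J k"
  show "x +o Im_space M J k = Im_space M J k"
  proof (intro set_eqI iffI)
    fix y assume "y \<in> x +o Im_space M J k"
    then show "y \<in> Im_space M J k" using x Im_space_add by (auto simp: elt_set_plus_def)
  next
    fix y assume "y \<in> Im_space M J k"
    then have "- x + y \<in> Im_space M J k" using x by (intro Im_space_add Im_space_uminus)
    then show "y \<in> x +o Im_space M J k"
      using set_plus_intro2[of "- x + y" "Im_space M J k" x] by simp
  qed
qed

lemma Im_space_plus: "Im_space M J k + Im_space M J k = Im_space M J k"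
proof -
  have "x \<in> Im_space M J k + Im_space M J k" if "x \<in> Im_space M J k" for x
    using set_plus_intro[OF that Im_space_zero] by simp
  then show ?thesis by (auto elim!: set_plus_elim intro: Im_space_add)
qed

lemma coset_plus_coset: "(x +o Im_space M J k) + (y +o Im_space M J k) = (x + y) +o Im_space M J k"
  unfolding set_plus_rearrange Im_space_plus ..

text \<open>The image of a coset is only a translate of \<open>comb a b\<close> applied to the image
  of \<open>D\<close>; the summand in \<open>induced\<close> completes it to a full coset.\<close>

lemma induced_coset:
  assumes x: "x \<in> forms M k"
  shows "induced M J (k + 1) (comb a b) (x +o Im_space M J k) = comb a b x +o Im_space M J (k + 1)"
proof -
  have coset: "y +o S = (\<lambda>s. y + s) ` S" for y :: "'a form" and S
    by (auto simp: elt_set_plus_def)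
  have "comb a b ` (x +o Im_space M J k) = comb a b x +o comb a b ` Im_space M J k"
    unfolding coset image_image
    by (rule image_cong[OF refl comb_add[OF x Im_space_forms]])
  \<comment> \<open>The first summand lies in the second by \<open>comb_Im_space\<close> and
    contains zero, so it is absorbed.\<close>
  moreover have "comb a b ` Im_space M J k + Im_space M J (k + 1) = Im_space M J (k + 1)"
  proof (intro set_eqI iffI)
    fix y assume "y \<in> comb a b ` Im_space M J k + Im_space M J (k + 1)"
    then show "y \<in> Im_space M J (k + 1)"
      using comb_Im_space Im_space_add by (auto elim!: set_plus_elim)
  next
    fix y assume y: "y \<in> Im_space M J (k + 1)"
    have "comb a b 0 = 0"
      using comb_cscale[OF forms_zero, of a b 0] by (simp add: cscale_def zero_fun_def)
    then have "0 \<in> comb a b ` Im_space M J k"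
      using Im_space_zero by (metis imageI)
    from set_plus_intro[OF this y] show "y \<in> comb a b ` Im_space M J k + Im_space M J (k + 1)" by simp
  qed
  ultimately show ?thesis
    unfolding induced_def by (simp add: set_plus_rearrange3)
qed

text \<open>Modulo the image of \<open>D\<close>, the composition in \<open>comb_comb\<close> is an
  invertible multiple of \<open>d dc\<close>.\<close>

lemma prod_ker_comb:
  assumes ne: "a * b' - b * a' \<noteq> 0"
  shows "prod_ker M J (comb a b) (comb a' b') k =
    (\<lambda>\<alpha>. \<alpha> +o Im_space M J k) ` {\<alpha> \<in> forms M k. d (dc \<alpha>) \<in> Im_space M J (k + 2)}"
proof -
  have "induced M J (k + 2) (comb a b) (induced M J (k + 1) (comb a' b') (\<alpha> +o Im_space M J k))
      = Im_space M J (k + 2) \<longleftrightarrow> d (dc \<alpha>) \<in> Im_space M J (k + 2)" if \<alpha>: "\<alpha> \<in> forms M k" for \<alpha>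
  proof -
    let ?I = "Im_space M J (k + 2)"
    have D: "D \<alpha> \<in> ?I" using \<alpha> by (simp add: Im_space_def)
    have "induced M J (k + 2) (comb a b) (induced M J (k + 1) (comb a' b') (\<alpha> +o Im_space M J k))
        = comb a b (comb a' b' \<alpha>) +o ?I"
      using induced_coset[OF comb_forms[OF \<alpha>], of a b a' b'] unfolding induced_coset[OF \<alpha>]
      by (simp add: add.assoc)
    also have "\<dots> = ?I \<longleftrightarrow> comb a b (comb a' b' \<alpha>) \<in> ?I"
      by (rule coset_eq_Im_space_iff)
    also have "\<dots> \<longleftrightarrow> d (dc \<alpha>) \<in> ?I"
    proof
      assume "d (dc \<alpha>) \<in> ?I"
      then show "comb a b (comb a' b' \<alpha>) \<in> ?I"
        unfolding comb_comb[OF \<alpha>] by (intro Im_space_add Im_space_cscale D)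
    next
      assume *: "comb a b (comb a' b' \<alpha>) \<in> ?I"
      have "d (dc \<alpha>) = cscale (1 / (a * b' - b * a'))
          (comb a b (comb a' b' \<alpha>) + cscale (- (b * a')) (D \<alpha>))"
        unfolding comb_comb[OF \<alpha>] using ne by (simp add: cscale_def fun_eq_iff)
      then show "d (dc \<alpha>) \<in> ?I"
        using * D by (simp only:) (intro Im_space_add Im_space_cscale)
    qed
    finally show ?thesis .
  qed
  then show ?thesis
    unfolding prod_ker_def C_space_def quotient_space_def by blast
qed

lemma prod_im_comb:
  assumes ne: "a * b' - b * a' \<noteq> 0"
  shows "prod_im M J (comb a b) (comb a' b') k =
    {(d \<alpha> + dc \<beta>) +o Im_space M J k | \<alpha> \<beta>. \<alpha> \<in> forms M (k - 1) \<and> \<beta> \<in> forms M (k - 1)}"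
    (is "_ = ?R")
proof -
  let ?I = "Im_space M J k" and ?F = "forms M (k - 1)"
  have ind: "induced M J k (comb x y) (\<alpha> +o Im_space M J (k - 1)) = comb x y \<alpha> +o ?I"
    if "\<alpha> \<in> ?F" for \<alpha> x y
    using induced_coset[OF that] by simp
  \<comment> \<open>The sum of two sets of cosets is first rewritten as a set of cosets of sums,
    which reduces the claim to representatives.\<close>
  have "prod_im M J (comb a b) (comb a' b') k =
      {(comb a b \<alpha> + comb a' b' \<beta>) +o ?I | \<alpha> \<beta>. \<alpha> \<in> ?F \<and> \<beta> \<in> ?F}"
  proof -
    have "induced M J k (comb x y) ` C_space M J (k - 1) = {comb x y \<alpha> +o ?I | \<alpha>. \<alpha> \<in> ?F}" for x y
      unfolding C_space_def quotient_space_def image_image Setcompr_eq_image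
      by (simp add: ind)
    note im = this
    show ?thesis
      unfolding prod_im_def im
    proof (intro set_eqI iffI)
      fix S assume "S \<in> {comb a b \<alpha> +o ?I | \<alpha>. \<alpha> \<in> ?F} + {comb a' b' \<alpha> +o ?I | \<alpha>. \<alpha> \<in> ?F}"
      then obtain \<alpha> \<beta> where "\<alpha> \<in> ?F" "\<beta> \<in> ?F"
        "S = (comb a b \<alpha> +o ?I) + (comb a' b' \<beta> +o ?I)"
        by (elim set_plus_elim CollectE exE conjE) simp
      then show "S \<in> {(comb a b \<alpha> + comb a' b' \<beta>) +o ?I | \<alpha> \<beta>. \<alpha> \<in> ?F \<and> \<beta> \<in> ?F}"
        unfolding coset_plus_coset by blast
    next
      fix S assume "S \<in> {(comb a b \<alpha> + comb a' b' \<beta>) +o ?I | \<alpha> \<beta>. \<alpha> \<in> ?F \<and> \<beta> \<in> ?F}"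
      then obtain \<alpha> \<beta> where "\<alpha> \<in> ?F" "\<beta> \<in> ?F" and
        S: "S = (comb a b \<alpha> +o ?I) + (comb a' b' \<beta> +o ?I)"
        unfolding coset_plus_coset by blast
      then show "S \<in> {comb a b \<alpha> +o ?I | \<alpha>. \<alpha> \<in> ?F} + {comb a' b' \<alpha> +o ?I | \<alpha>. \<alpha> \<in> ?F}"
        unfolding S by (intro set_plus_intro) blast+
    qed
  qed
  also have "\<dots> = ?R"
  proof (intro set_eqI iffI)
    fix S assume "S \<in> {(comb a b \<alpha> + comb a' b' \<beta>) +o ?I | \<alpha> \<beta>. \<alpha> \<in> ?F \<and> \<beta> \<in> ?F}"
    then obtain \<alpha> \<beta> where S: "S = (comb a b \<alpha> + comb a' b' \<beta>) +o ?I" and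
      f: "\<alpha> \<in> ?F" "\<beta> \<in> ?F" by blast
    \<comment> \<open>The arguments are collected by operator, which applies the transposed
      coefficient matrix to \<open>\<alpha>\<close> and \<open>\<beta>\<close>.\<close>
    let ?\<alpha> = "cscale a \<alpha> + cscale a' \<beta>" and ?\<beta> = "cscale b \<alpha> + cscale b' \<beta>"
    have "comb a b \<alpha> + comb a' b' \<beta> = d ?\<alpha> + dc ?\<beta>"
      unfolding comb_def ext_d_add[OF forms_cscale[OF f(1)] forms_cscale[OF f(2)]]
        dc_add[OF forms_cscale[OF f(1)] forms_cscale[OF f(2)]]
        ext_d_cscale[OF f(1)] ext_d_cscale[OF f(2)] dc_cscale[OF f(1)] dc_cscale[OF f(2)]
      by (simp add: fun_eq_iff)
    moreover have "?\<alpha> \<in> ?F" "?\<beta> \<in> ?F" by (intro forms_add forms_cscale f)+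
    ultimately show "S \<in> ?R"
      unfolding S by (intro CollectI exI[of _ ?\<alpha>] exI[of _ ?\<beta>]) simp
  next
    fix S assume "S \<in> ?R"
    then obtain \<alpha> \<beta> where S: "S = (d \<alpha> + dc \<beta>) +o ?I" and f: "\<alpha> \<in> ?F" "\<beta> \<in> ?F" by blast
    define c where "c = 1 / (a * b' - b * a')"
    have c: "c * (a * b' - b * a') = 1" using ne by (simp add: c_def)
    \<comment> \<open>The inverse of the transposed coefficient matrix, with \<open>c\<close> the
      inverse determinant.\<close>
    let ?\<alpha> = "cscale (c * b') \<alpha> + cscale (- c * a') \<beta>"
    let ?\<beta> = "cscale (- c * b) \<alpha> + cscale (c * a) \<beta>"
    have "(comb a b ?\<alpha> + comb a' b' ?\<beta>) Xs p = (d \<alpha> + dc \<beta>) Xs p" for Xs p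
    proof -
      have "(comb a b ?\<alpha> + comb a' b' ?\<beta>) Xs p =
          c * (a * b' - b * a') * d \<alpha> Xs p + c * (a * b' - b * a') * dc \<beta> Xs p"
        unfolding comb_add[OF forms_cscale[OF f(1)] forms_cscale[OF f(2)]]
          comb_cscale[OF f(1)] comb_cscale[OF f(2)]
        by (simp add: comb_def cscale_def algebra_simps)
      then show ?thesis unfolding c by simp
    qed
    then have "comb a b ?\<alpha> + comb a' b' ?\<beta> = d \<alpha> + dc \<beta>" by blast
    moreover have "?\<alpha> \<in> ?F" "?\<beta> \<in> ?F" by (intro forms_add forms_cscale f)+
    ultimately show "S \<in> {(comb a b \<alpha> + comb a' b' \<beta>) +o ?I | \<alpha> \<beta>. \<alpha> \<in> ?F \<and> \<beta> \<in> ?F}"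
      unfolding S by (intro CollectI exI[of _ ?\<alpha>] exI[of _ ?\<beta>]) simp
  qed
  finally show ?thesis .
qed

end

theorem proposition3p15:
  fixes M :: "'a manifold" and J :: "'a vfield \<Rightarrow> 'a vfield" and m :: nat
  assumes "almost_complex_manifold m M J"
  shows "\<forall>k. sum_ker M J (ext_d M) (ext_dc M J) k = sum_ker M J (delta M J) (delta_bar M J) k \<and>
             sum_im M J (ext_d M) (ext_dc M J) k = sum_im M J (delta M J) (delta_bar M J) k \<and>
             H_sum M J (ext_d M) (ext_dc M J) k = H_sum M J (delta M J) (delta_bar M J) k \<and>
             prod_ker M J (ext_d M) (ext_dc M J) k = prod_ker M J (delta M J) (delta_bar M J) k \<and>
             prod_im M J (ext_d M) (ext_dc M J) k = prod_im M J (delta M J) (delta_bar M J) k \<and>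
             H_prod M J (ext_d M) (ext_dc M J) k = H_prod M J (delta M J) (delta_bar M J) k"
proof -
  interpret almost_complex M J m
    by unfold_locales (rule assms)
  \<comment> \<open>The determinants of the two pairs: \<open>1\<close> for \<open>d\<close>,
    \<open>dc\<close> and \<open>-\<i>/2\<close> for \<open>delta\<close>,
    \<open>delta_bar\<close>.\<close>
  have ne: "(1::complex) * 1 - 0 * 0 \<noteq> 0" "(1/2) * (-\<i>/2) - \<i>/2 * (1/2) \<noteq> 0"
    by (simp_all add: field_simps)
  \<comment> \<open>Both instances have the same coefficient-free right-hand side; folding
    \<open>comb\<close> back into the four operators gives the equality.\<close>
  have "sum_ker M J d dc k = sum_ker M J (delta M J) (delta_bar M J) k" for k
    using sum_ker_comb[OF ne(1), of k] sum_ker_comb[OF ne(2), of k]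
    unfolding comb_ext_d[symmetric] comb_ext_dc[symmetric] comb_delta[symmetric]
      comb_delta_bar[symmetric] by (rule trans[OF _ sym])
  moreover have "sum_im M J d dc k = sum_im M J (delta M J) (delta_bar M J) k" for k
    using sum_im_comb[OF ne(1), of k] sum_im_comb[OF ne(2), of k]
    unfolding comb_ext_d[symmetric] comb_ext_dc[symmetric] comb_delta[symmetric]
      comb_delta_bar[symmetric] by (rule trans[OF _ sym])
  moreover have "prod_ker M J d dc k = prod_ker M J (delta M J) (delta_bar M J) k" for k
    using prod_ker_comb[OF ne(1), of k] prod_ker_comb[OF ne(2), of k]
    unfolding comb_ext_d[symmetric] comb_ext_dc[symmetric] comb_delta[symmetric]
      comb_delta_bar[symmetric] by (rule trans[OF _ sym])
  moreover have "prod_im M J d dc k = prod_im M J (delta M J) (delta_bar M J) k" for k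
    using prod_im_comb[OF ne(1), of k] prod_im_comb[OF ne(2), of k]
    unfolding comb_ext_d[symmetric] comb_ext_dc[symmetric] comb_delta[symmetric]
      comb_delta_bar[symmetric] by (rule trans[OF _ sym])
  ultimately show ?thesis
    by (simp add: H_sum_def H_prod_def)
qed

end
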